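(* Let $\mathcal H$ be a real Hilbert space, let $z\in\mathcal H$, let $m\geq 1$ be an integer, let $A\colon\mathcal H\to 2^{\mathcal H}$ be maximally monotone, and let $C\colon\mathcal H\to\mathcal H$ be monotone and $\mu$-Lipschitzian for some $\mu\in\,]0,+\infty[$. For every $i\in\{1,\ldots,m\}$, let $\mathcal G_i$ be a real Hilbert space, let $r_i\in\mathcal G_i$, let $B_i\colon\mathcal G_i\to 2^{\mathcal G_i}$ be maximally monotone, let $D_i\colon\mathcal G_i\to 2^{\mathcal G_i}$ be monotone and such that $D_i^{-1}$ is $\nu_i$-Lipschitzian for some $\nu_i\in\,]0,+\infty[$, and let $L_i\colon\mathcal H\to\mathcal G_i$ be a nonzero bounded linear operator. Consider the primal inclusion $$\text{(P)}\quad\text{find } \overline{x}\in\mathcal H\text{ such that } z\in A\overline{x}+\sum_{i=1}^m L_i^*\big((B_i\,\square\, D_i)(L_i\overline{x}-r_i)\big)+C\overline{x},$$ and the dual inclusion $$\text{(D)}\quad\text{find } \overline{v_1}\in\mathcal G_1,\ldots,\overline{v_m}\in\mathcal G_m\text{ such that } (\exists\, x\in\mathcal H)\ \begin{cases} z-\sum_{i=1}^m L_i^*\overline{v_i}\in Ax+Cx\\ (\forall i\in\{1,\ldots,m\})\ \overline{v_i}\in(B_i\,\square\, D_i)(L_ix-r_i).\end{cases}$$ Suppose that $$z\in\operatorname{ran}\Big(A+\sum_{i=1}^m L_i^*(B_i\,\square\, D_i)(L_i\cdot-r_i)+C\Big).$$ Let $(a_{1,n})_{n\in\mathbb N}$,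 $(b_{1,n})_{n\in\mathbb N}$, and $(c_{1,n})_{n\in\mathbb N}$ be absolutely summable sequences in $\mathcal H$ and, for every $i\in\{1,\ldots,m\}$, let $(a_{2,i,n})_{n\in\mathbb N}$, $(b_{2,i,n})_{n\in\mathbb N}$, and $(c_{2,i,n})_{n\in\mathbb N}$ be absolutely summable sequences in $\mathcal G_i$. Set $$\beta=\max\{\mu,\nu_1,\ldots,\nu_m\}+\sqrt{\sum_{i=1}^m\|L_i\|^2},$$ let $x_0\in\mathcal H$, let $(v_{1,0},\ldots,v_{m,0})\in\mathcal G_1\oplus\cdots\oplus\mathcal G_m$, let $\varepsilon\in\,]0,1/(\beta+1)[$, let $(\gamma_n)_{n\in\mathbb N}$ be a sequence in $[\varepsilon,(1-\varepsilon)/\beta]$, and define recursively, for every $n\in\mathbb N$, $$\begin{aligned} y_{1,n}&=x_n-\gamma_n\Big(Cx_n+\sum_{i=1}^m L_i^*v_{i,n}+a_{1,n}\Big),\\ p_{1,n}&=J_{\gamma_n A}(y_{1,n}+\gamma_n z)+b_{1,n},\\ &\text{for } i=1,\ldots,m:\\ &\quad y_{2,i,n}=v_{i,n}+\gamma_n\big(L_ix_n-D_i^{-1}v_{i,n}+a_{2,i,n}\big),\\ &\quad p_{2,i,n}=J_{\gamma_n B_i^{-1}}(y_{2,i,n}-\gamma_n r_i)+b_{2,i,n},\\ &\quad q_{2,i,n}=p_{2,i,n}+\gamma_n\big(L_ip_{1,n}-D_i^{-1}p_{2,i,n}+c_{2,i,n}\big),\\ &\quad v_{i,n+1}=v_{i,n}-y_{2,i,n}+q_{2,i,n},\\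 q_{1,n}&=p_{1,n}-\gamma_n\Big(Cp_{1,n}+\sum_{i=1}^m L_i^*p_{2,i,n}+c_{1,n}\Big),\\ x_{n+1}&=x_n-y_{1,n}+q_{1,n}. \end{aligned}$$ Then the following hold. (i) $\sum_{n\in\mathbb N}\|x_n-p_{1,n}\|^2<+\infty$ and, for every $i\in\{1,\ldots,m\}$, $\sum_{n\in\mathbb N}\|v_{i,n}-p_{2,i,n}\|^2<+\infty$. (ii) There exist a solution $\overline{x}$ to (P) and a solution $(\overline{v_1},\ldots,\overline{v_m})$ to (D) such that the following hold. (a) $z-\sum_{j=1}^m L_j^*\overline{v_j}\in A\overline{x}+C\overline{x}$ and, for every $i\in\{1,\ldots,m\}$, $L_i\overline{x}-r_i\in B_i^{-1}\overline{v_i}+D_i^{-1}\overline{v_i}$. (b) For every $i\in\{1,\ldots,m\}$, $-r_i\in -L_i\big((A^{-1}\,\square\, C^{-1})\big(z-\sum_{j=1}^m L_j^*\overline{v_j}\big)\big)+B_i^{-1}\overline{v_i}+D_i^{-1}\overline{v_i}$. (c) $x_n\rightharpoonup\overline{x}$ and $p_{1,n}\rightharpoonup\overline{x}$. (d) For every $i\in\{1,\ldots,m\}$, $v_{i,n}\rightharpoonup\overline{v_i}$ and $p_{2,i,n}\rightharpoonup\overline{v_i}$. (e) Suppose that $A$ or $C$ is uniformly monotone at $\overline{x}$. Then $x_n\to\overline{x}$ and $p_{1,n}\to\overline{x}$. (f) Suppose that, for some $i\in\{1,\ldots,m\}$, $B_i^{-1}$ or $D_i^{-1}$ is uniformly monotone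 at $\overline{v_i}$. Then $v_{i,n}\to\overline{v_i}$ and $p_{2,i,n}\to\overline{v_i}$.
   Context: Notation: $\rightharpoonup$ and $\to$ denote weak and strong convergence. $\mathcal G_1\oplus\cdots\oplus\mathcal G_m$ is the Hilbert direct sum (product space with norm $\sqrt{\sum_i\|y_i\|^2}$). A sequence $(a_n)$ is absolutely summable if $\sum_n\|a_n\|<+\infty$. $L_i^*$ is the adjoint of $L_i$. Let $\mathcal K$ be a real Hilbert space and $M\colon\mathcal K\to 2^{\mathcal K}$ a set-valued operator. Its graph is $\operatorname{gra}M=\{(x,u)\in\mathcal K\times\mathcal K: u\in Mx\}$, its domain is $\operatorname{dom}M=\{x\in\mathcal K: Mx\neq\varnothing\}$, its range is $\operatorname{ran}M=\{u\in\mathcal K: (\exists x\in\mathcal K)\ u\in Mx\}$, and its inverse $M^{-1}$ is the set-valued operator with graph $\{(u,x): u\in Mx\}$. Single-valued operators are identified with set-valued operators having singleton values; "$D_i^{-1}$ is $\nu_i$-Lipschitzian" means that $D_i^{-1}$ is a single-valued $\nu_i$-Lipschitz map $\mathcal G_i\to\mathcal G_i$. Sums, and images of sets under linear operators, are taken in the Minkowski/pointwise sense; the operator $A+\sum_{i}L_i^*(B_i\,\square\,D_i)(L_i\cdot-r_i)+C$ is $x\mapsto Ax+\sum_i L_i^*\big((B_i\,\square\,D_i)(L_ix-r_i)\big)+Cx$. The resolvent of $M$ is $J_M=(\operatorname{Id}+M)^{-1}$ (single-valued and everywhere defined when $M$ is maximally monotone). $M$ is monotone if $\langle x-y\mid u-v\rangle\geq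 0$ for all $(x,u),(y,v)\in\operatorname{gra}M$, and maximally monotone if, in addition, no monotone operator has a graph strictly containing $\operatorname{gra}M$. $M$ is uniformly monotone at $x\in\operatorname{dom}M$ if there exists an increasing function $\phi\colon[0,+\infty[\,\to[0,+\infty]$ that vanishes only at $0$ such that, for all $u\in Mx$ and all $(y,v)\in\operatorname{gra}M$, $\langle x-y\mid u-v\rangle\geq\phi(\|x-y\|)$. The parallel sum of two set-valued operators $M_1,M_2\colon\mathcal K\to 2^{\mathcal K}$ is $M_1\,\square\,M_2=(M_1^{-1}+M_2^{-1})^{-1}$. *)

theory Defs
  imports "HOL-Analysis.Analysis" "HOL-Library.Set_Algebras"
begin

text \<open>
  Set-valued operators are functions into sets. On sets, \<open>+\<close> and \<open>\<Sum>\<close> are the Minkowski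
  operations of \<^theory>\<open>HOL-Library.Set_Algebras\<close>; \<open>-\<close> stays the set difference (and complement),
  so negatives of sets are written as images.

  The spaces \<open>G\<^sub>1, \<dots>, G\<^sub>m\<close> may be different Hilbert spaces, so they cannot all be one type. They are
  closed subspaces of one Hilbert space type (every finite family of Hilbert spaces is of this
  form inside its Hilbert direct sum). An operator on a subspace \<open>K\<close> is one with graph in
  \<open>K \<times> K\<close>: it is empty-valued outside \<open>K\<close>.
\<close>

definition gra :: "('a \<Rightarrow> 'b set) \<Rightarrow> ('a \<times> 'b) set" where
  "gra M = {(x, u). u \<in> M x}"

definition op_dom :: "('a \<Rightarrow> 'b set) \<Rightarrow> 'a set" where
  "op_dom M = {x. M x \<noteq> {}}"

definition op_ran :: "('a \<Rightarrow> 'b set) \<Rightarrow> 'b set" where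
  "op_ran M = {u. \<exists>x. u \<in> M x}"

definition op_inverse :: "('a \<Rightarrow> 'b set) \<Rightarrow> 'b \<Rightarrow> 'a set" where
  "op_inverse M u = {x. u \<in> M x}"

definition single_valued_op :: "('a \<Rightarrow> 'b) \<Rightarrow> 'a \<Rightarrow> 'b set" where
  "single_valued_op T x = {T x}"

definition scale_op :: "real \<Rightarrow> ('a \<Rightarrow> 'b::real_vector set) \<Rightarrow> 'a \<Rightarrow> 'b set" where
  "scale_op c M x = (\<lambda>u. c *\<^sub>R u) ` M x"

definition resolvent :: "('a::real_vector \<Rightarrow> 'a set) \<Rightarrow> 'a \<Rightarrow> 'a set" where
  "resolvent M = op_inverse (\<lambda>x. {x} + M x)"

definition parallel_sum ::
    "('a \<Rightarrow> 'b::real_vector set) \<Rightarrow> ('a::real_vector \<Rightarrow> 'b set) \<Rightarrow> 'a \<Rightarrow> 'b set" where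
  "parallel_sum M1 M2 = op_inverse (\<lambda>u. op_inverse M1 u + op_inverse M2 u)"

definition operator_on :: "'a set \<Rightarrow> ('a \<Rightarrow> 'a set) \<Rightarrow> bool" where
  "operator_on K M \<longleftrightarrow> gra M \<subseteq> K \<times> K"

definition monotone_op :: "('a::real_inner \<Rightarrow> 'a set) \<Rightarrow> bool" where
  "monotone_op M \<longleftrightarrow> (\<forall>(x, u) \<in> gra M. \<forall>(y, v) \<in> gra M. (x - y) \<bullet> (u - v) \<ge> 0)"

definition maximally_monotone_on :: "'a::real_inner set \<Rightarrow> ('a \<Rightarrow> 'a set) \<Rightarrow> bool" where
  "maximally_monotone_on K M \<longleftrightarrow>
     operator_on K M \<and> monotone_op M \<and>
     \<not> (\<exists>N. operator_on K N \<and> monotone_op N \<and> gra M \<subset> gra N)"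

definition lipschitzian_op_on :: "real \<Rightarrow> 'a::real_normed_vector set \<Rightarrow> ('a \<Rightarrow> 'a set) \<Rightarrow> bool" where
  "lipschitzian_op_on \<nu> K M \<longleftrightarrow>
     operator_on K M \<and> (\<exists>T. (\<forall>x\<in>K. M x = {T x}) \<and> \<nu>-lipschitz_on K T)"

text \<open>
  As usual in monotone operator theory, "increasing" means nondecreasing.
\<close>

definition uniformly_monotone_at :: "('a::real_inner \<Rightarrow> 'a set) \<Rightarrow> 'a \<Rightarrow> bool" where
  "uniformly_monotone_at M x \<longleftrightarrow>
     x \<in> op_dom M \<and>
     (\<exists>\<phi> :: real \<Rightarrow> ereal.
        (\<forall>t\<ge>0. 0 \<le> \<phi> t) \<and> mono_on {0..} \<phi> \<and> (\<forall>t\<ge>0. \<phi> t = 0 \<longleftrightarrow> t = 0) \<and>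
        (\<forall>u \<in> M x. \<forall>(y, v) \<in> gra M. ereal ((x - y) \<bullet> (u - v)) \<ge> \<phi> (norm (x - y))))"

definition weakly_converges_on :: "'a::real_inner set \<Rightarrow> (nat \<Rightarrow> 'a) \<Rightarrow> 'a \<Rightarrow> bool" where
  "weakly_converges_on K s l \<longleftrightarrow> (\<forall>w\<in>K. (\<lambda>n. s n \<bullet> w) \<longlonglongrightarrow> l \<bullet> w)"

text \<open>
  For a bounded linear \<open>L i\<close> with values in \<open>G i\<close>, the adjoint of \<open>L i\<close> as a map into
  \<open>G i\<close> is the restriction to \<open>G i\<close> of \<open>adjoint (L i)\<close>, which is only applied to points of \<open>G i\<close>.
\<close>

definition primal_op ::
    "nat \<Rightarrow> ('h::real_inner \<Rightarrow> 'h set) \<Rightarrow> (nat \<Rightarrow> 'g::real_inner \<Rightarrow> 'g set) \<Rightarrow>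
     (nat \<Rightarrow> 'g \<Rightarrow> 'g set) \<Rightarrow> (nat \<Rightarrow> 'h \<Rightarrow> 'g) \<Rightarrow> (nat \<Rightarrow> 'g) \<Rightarrow> ('h \<Rightarrow> 'h) \<Rightarrow> 'h \<Rightarrow> 'h set" where
  "primal_op m A B D L r C x =
     A x + (\<Sum>i=1..m. adjoint (L i) ` parallel_sum (B i) (D i) (L i x - r i)) + {C x}"

definition primal_solution ::
    "nat \<Rightarrow> 'h \<Rightarrow> ('h::real_inner \<Rightarrow> 'h set) \<Rightarrow> (nat \<Rightarrow> 'g::real_inner \<Rightarrow> 'g set) \<Rightarrow>
     (nat \<Rightarrow> 'g \<Rightarrow> 'g set) \<Rightarrow> (nat \<Rightarrow> 'h \<Rightarrow> 'g) \<Rightarrow> (nat \<Rightarrow> 'g) \<Rightarrow> ('h \<Rightarrow> 'h) \<Rightarrow> 'h \<Rightarrow> bool" where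
  "primal_solution m z A B D L r C x \<longleftrightarrow> z \<in> primal_op m A B D L r C x"

definition dual_solution ::
    "nat \<Rightarrow> (nat \<Rightarrow> 'g set) \<Rightarrow> 'h \<Rightarrow> ('h::real_inner \<Rightarrow> 'h set) \<Rightarrow>
     (nat \<Rightarrow> 'g::real_inner \<Rightarrow> 'g set) \<Rightarrow> (nat \<Rightarrow> 'g \<Rightarrow> 'g set) \<Rightarrow> (nat \<Rightarrow> 'h \<Rightarrow> 'g) \<Rightarrow>
     (nat \<Rightarrow> 'g) \<Rightarrow> ('h \<Rightarrow> 'h) \<Rightarrow> (nat \<Rightarrow> 'g) \<Rightarrow> bool" where
  "dual_solution m G z A B D L r C v \<longleftrightarrow>
     (\<forall>i\<in>{1..m}. v i \<in> G i) \<and>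
     (\<exists>x. z - (\<Sum>i=1..m. adjoint (L i) (v i)) \<in> A x + {C x} \<and>
          (\<forall>i\<in>{1..m}. v i \<in> parallel_sum (B i) (D i) (L i x - r i)))"

end

theory Submission
  imports Defs "HOL-Complex_Analysis.Great_Picard"
begin

text \<open>
  On the product space of points \<open>p = (x, v\<^sub>1, \<dots>, v\<^sub>m)\<close> put
  \<open>M p = (A x - z) \<times> (B\<^sub>1\<^sup>-\<^sup>1 v\<^sub>1 + r\<^sub>1) \<times> \<dots> \<times> (B\<^sub>m\<^sup>-\<^sup>1 v\<^sub>m + r\<^sub>m)\<close> and
  \<open>Q p = (C x + \<Sum>\<^sub>i L\<^sub>i\<^sup>* v\<^sub>i, D\<^sub>1\<^sup>-\<^sup>1 v\<^sub>1 - L\<^sub>1 x, \<dots>, D\<^sub>m\<^sup>-\<^sup>1 v\<^sub>m - L\<^sub>m x)\<close>.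
  The coupling between \<open>x\<close> and the \<open>v\<^sub>i\<close> is skew, so it cancels in \<open>\<langle>p - p', Q p - Q p'\<rangle>\<close>: the
  map \<open>Q\<close> is monotone, and it is Lipschitzian with the constant \<open>\<beta>\<close>. The zeros of \<open>M + Q\<close> are the
  pairs of primal and dual solutions that belong to the same optimality system
  (\<open>kkt_iff_zero\<close>, \<open>solutions_if_kkt\<close>), and the range condition on \<open>z\<close> says that there is one.
  The algorithm is the forward-backward-forward iteration for \<open>M + Q\<close>, with summable errors.

  Without errors, one step of that iteration decreases the squared distance to every zero of
  \<open>M + Q\<close> by a fixed multiple of the squared length of the forward-backward step
  (\<open>forward_backward_forward_step\<close>). Summable errors preserve this up to a summable term, so that
  the distances to the zeros converge and the squared step lengths are summable. Every weak cluster
  point is a zero, because the residual in \<open>(M + Q) p\<^sub>n\<close> tends to \<open>0\<close> and the graph of a maximally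
  monotone operator is closed for weak convergence of points and strong convergence of images;
  Opial's argument then gives weak convergence (\<open>forward_backward_forward_converges\<close>).
  Finally, the inner product of \<open>p\<^sub>n - p\<close> with the residual is a sum of nonnegative terms, one for
  each of \<open>A\<close>, \<open>C\<close>, \<open>B\<^sub>i\<^sup>-\<^sup>1\<close>, \<open>D\<^sub>i\<^sup>-\<^sup>1\<close>, and tends to \<open>0\<close>. Each term hence tends to \<open>0\<close>, and uniform
  monotonicity of one of the operators turns this into strong convergence of its own
  component (\<open>strong_convergence\<close>).

  Two existence results underlie this: adjoints exist (Riesz), and resolvents of maximally monotone
  operators are defined everywhere (Minty). Both are instances of the existence of a minimizer of
  \<open>t + \<parallel>w\<parallel>\<^sup>2 / 2\<close> over a closed convex set of pairs \<open>(w, t)\<close> (\<open>convex_epigraph_minimizer\<close>).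

  The product space is realized as the product of the primal space with the square-summable
  sequences over the type that contains all the \<open>G i\<close>. The number \<open>m\<close> of factors is a
  variable, and one Hilbert space type accommodates all its values.
\<close>

section \<open>Convex minimization, adjoints and Minty's theorem\<close>

text \<open>
  The parallelogram law makes \<open>t + \<parallel>w\<parallel>\<^sup>2 / 2\<close> strongly convex, so the first components of a minimizing
  sequence are Cauchy. The last conclusion is the first-order optimality condition: move from
  \<open>(w0, t0)\<close> towards \<open>(w, t)\<close> by a fraction \<open>s\<close>, divide by \<open>s\<close>, and let \<open>s\<close> tend to \<open>0\<close>.
\<close>

lemma convex_epigraph_minimizer:
  fixes S :: "('w::{real_inner,complete_space} \<times> real) set"
  assumes ne: "S \<noteq> {}" and cv: "convex S" and cl: "closed S"
    and lb: "\<And>w t. (w, t) \<in> S \<Longrightarrow> l \<le> t + (norm w)\<^sup>2 / 2"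
  obtains w0 t0 where "(w0, t0) \<in> S" "\<And>w t. (w, t) \<in> S \<Longrightarrow> t0 \<le> t + w0 \<bullet> (w - w0)"
proof -
  define J :: "'w \<times> real \<Rightarrow> real" where "J = (\<lambda>e. snd e + (norm (fst e))\<^sup>2 / 2)"
  define I where "I = Inf (J ` S)"
  have bdd: "bdd_below (J ` S)"
    using lb by (intro bdd_belowI[of _ l]) (auto simp: J_def)
  have I_le: "I \<le> J e" if "e \<in> S" for e
    unfolding I_def using that bdd by (intro cInf_lower) auto
  have "\<exists>e\<in>S. J e < I + 1 / real (Suc n)" for n
  proof -
    have "Inf (J ` S) < I + 1 / real (Suc n)" by (simp add: I_def)
    then show ?thesis using cInf_lessD[of "J ` S"] ne by auto
  qed
  then obtain e where eS: "\<And>n. e n \<in> S" and eJ: "\<And>n. J (e n) < I + 1 / real (Suc n)"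
    by metis
  have mid: "(norm (fst a - fst b))\<^sup>2 \<le> 4 * ((J a - I) + (J b - I))" if "a \<in> S" "b \<in> S" for a b
  proof -
    have "(1/2) *\<^sub>R a + (1/2) *\<^sub>R b \<in> S"
      using cv that by (intro convexD) auto
    then have "I \<le> J ((1/2) *\<^sub>R a + (1/2) *\<^sub>R b)" by (rule I_le)
    then show ?thesis
      by (simp add: J_def power2_norm_eq_inner inner_diff_left inner_diff_right inner_add_left
          inner_add_right inner_commute field_simps)
  qed
  have "Cauchy (\<lambda>n. fst (e n))"
  proof (rule metric_CauchyI)
    fix d :: real assume d: "d > 0"
    obtain N :: nat where N: "8 / d\<^sup>2 < real N" using reals_Archimedean2 by blast
    have "dist (fst (e m)) (fst (e n)) < d" if "m \<ge> N" "n \<ge> N" for m n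
    proof -
      have Jd: "J (e k) - I < d\<^sup>2 / 8" if "k \<ge> N" for k
      proof -
        have "8 / d\<^sup>2 < real (Suc k)" using N that by linarith
        then have "1 / real (Suc k) < d\<^sup>2 / 8" using d by (simp add: field_simps)
        with eJ[of k] show ?thesis by linarith
      qed
      have "(norm (fst (e m) - fst (e n)))\<^sup>2 \<le> 4 * ((J (e m) - I) + (J (e n) - I))"
        using mid eS by blast
      also have "\<dots> < d\<^sup>2"
        using Jd[OF that(1)] Jd[OF that(2)] by (simp add: field_simps)
      finally show ?thesis using d by (simp add: dist_norm power2_less_imp_less)
    qed
    then show "\<exists>N. \<forall>m\<ge>N. \<forall>n\<ge>N. dist (fst (e m)) (fst (e n)) < d" by blast
  qed
  then obtain w0 where w0: "(\<lambda>n. fst (e n)) \<longlonglongrightarrow> w0"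
    using Cauchy_convergent convergent_def by blast
  have JI: "(\<lambda>n. J (e n)) \<longlonglongrightarrow> I"
  proof (rule tendsto_sandwich[of "\<lambda>_. I"])
    show "(\<lambda>n. I + 1 / real (Suc n)) \<longlonglongrightarrow> I"
      using tendsto_add[OF tendsto_const[of I] LIMSEQ_Suc[OF lim_1_over_n]] by simp
  qed (intro always_eventually allI I_le eS less_imp_le[OF eJ] tendsto_const)+
  define t0 where "t0 = I - (norm w0)\<^sup>2 / 2"
  have "(\<lambda>n. J (e n) - (norm (fst (e n)))\<^sup>2 / 2) \<longlonglongrightarrow> t0"
    unfolding t0_def by (intro tendsto_intros JI w0) auto
  then have "(\<lambda>n. snd (e n)) \<longlonglongrightarrow> t0" by (simp add: J_def)
  with w0 have "(\<lambda>n. (fst (e n), snd (e n))) \<longlonglongrightarrow> (w0, t0)" by (rule tendsto_Pair)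
  then have S0: "(w0, t0) \<in> S"
    using closed_sequentially[OF cl, of e] eS by simp
  show thesis
  proof (rule that[OF S0])
    fix w t assume wt: "(w, t) \<in> S"
    have *: "t0 \<le> t + w0 \<bullet> (w - w0) + s * ((norm (w - w0))\<^sup>2 / 2)" if s: "0 < s" "s < 1" for s :: real
    proof -
      have "(1 - s) *\<^sub>R (w0, t0) + s *\<^sub>R (w, t) \<in> S"
        using cv S0 wt s by (intro convexD) auto
      then have "I \<le> J ((1 - s) *\<^sub>R (w0, t0) + s *\<^sub>R (w, t))" by (rule I_le)
      also have "\<dots> = (1 - s) * t0 + s * t + (norm (w0 + s *\<^sub>R (w - w0)))\<^sup>2 / 2"
        by (simp add: J_def algebra_simps)
      also have "(norm (w0 + s *\<^sub>R (w - w0)))\<^sup>2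
          = (norm w0)\<^sup>2 + 2 * s * (w0 \<bullet> (w - w0)) + s * s * (norm (w - w0))\<^sup>2"
        unfolding power2_norm_eq_inner
        by (simp add: inner_add_left inner_add_right inner_commute)
      finally have "s * t0 \<le> s * (t + w0 \<bullet> (w - w0) + s * ((norm (w - w0))\<^sup>2 / 2))"
        by (simp add: t0_def power2_norm_eq_inner[of w0] field_simps inner_diff_right)
      then show ?thesis using s by simp
    qed
    have lim: "((\<lambda>s. t + w0 \<bullet> (w - w0) + s * ((norm (w - w0))\<^sup>2 / 2)) \<longlongrightarrow>
            t + w0 \<bullet> (w - w0) + 0 * ((norm (w - w0))\<^sup>2 / 2)) (at_right 0)"
      by (intro tendsto_intros)
    have ev: "eventually (\<lambda>s. t0 \<le> t + w0 \<bullet> (w - w0) + s * ((norm (w - w0))\<^sup>2 / 2)) (at_right 0)"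
      using * by (auto simp: eventually_at_right_field intro!: exI[of _ 1])
    show "t0 \<le> t + w0 \<bullet> (w - w0)"
      using tendsto_lowerbound[OF lim ev trivial_limit_at_right_real] by simp
  qed
qed

text \<open>
  The representing vector is the minimizer of \<open>\<parallel>w\<parallel>\<^sup>2 / 2 - f w\<close> over \<open>K\<close>; at \<open>w0 + h\<close> and \<open>w0 - h\<close> its
  optimality condition gives the two inequalities between \<open>f h\<close> and \<open>w0 \<bullet> h\<close>. Closed subspaces are
  covered because orthogonal projections are needed as well.
\<close>

lemma riesz_representation_on:
  fixes K :: "'a::{real_inner,complete_space} set" and f :: "'a \<Rightarrow> real"
  assumes K: "subspace K" "closed K"
    and add: "\<And>u v. u \<in> K \<Longrightarrow> v \<in> K \<Longrightarrow> f (u + v) = f u + f v"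
    and scale: "\<And>c u. u \<in> K \<Longrightarrow> f (c *\<^sub>R u) = c * f u"
    and bound: "\<And>u. u \<in> K \<Longrightarrow> \<bar>f u\<bar> \<le> c * norm u"
  obtains l where "l \<in> K" "\<And>u. u \<in> K \<Longrightarrow> f u = l \<bullet> u"
proof -
  define S where "S = {(w, t). w \<in> K \<and> - f w \<le> t}"
  have "(0, - f 0) \<in> S" using K by (auto simp: S_def subspace_0)
  then have ne: "S \<noteq> {}" by blast
  have cv: "convex S"
    unfolding convex_alt
  proof (intro ballI allI impI)
    fix p q :: "'a \<times> real" and s :: real assume pq: "p \<in> S" "q \<in> S" and s: "0 \<le> s \<and> s \<le> 1"
    obtain w t w' t' where [simp]: "p = (w, t)" "q = (w', t')" by (cases p, cases q)
    have w: "w \<in> K" "w' \<in> K" "- f w \<le> t" "- f w' \<le> t'" using pq by (auto simp: S_def)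
    have "f ((1 - s) *\<^sub>R w + s *\<^sub>R w') = (1 - s) * f w + s * f w'"
      using w K by (simp add: add scale subspace_scale)
    moreover have "(1 - s) * (- f w) + s * (- f w') \<le> (1 - s) * t + s * t'"
      using w s by (intro add_mono mult_left_mono) auto
    ultimately show "(1 - s) *\<^sub>R p + s *\<^sub>R q \<in> S"
      using w K by (simp add: S_def subspace_add subspace_scale)
  qed
  have cl: "closed S"
    unfolding closed_sequential_limits
  proof (intro allI impI)
    fix e and l :: "'a \<times> real" assume e: "(\<forall>n. e n \<in> S) \<and> e \<longlonglongrightarrow> l"
    have w: "(\<lambda>n. fst (e n)) \<longlonglongrightarrow> fst l" and t: "(\<lambda>n. snd (e n)) \<longlonglongrightarrow> snd l"
      using e by (auto intro: tendsto_fst tendsto_snd)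
    have eK: "fst (e n) \<in> K" "- f (fst (e n)) \<le> snd (e n)" for n
      using e by (auto simp: S_def split: prod.splits) (metis prod.collapse)+
    have lK: "fst l \<in> K" using closed_sequentially[OF K(2) _ w] eK by blast
    have "(\<lambda>n. f (fst (e n)) - f (fst l)) \<longlonglongrightarrow> 0"
    proof (rule Lim_null_comparison[where g = "\<lambda>n. c * norm (fst (e n) - fst l)"])
      have "f (fst (e n)) - f (fst l) = f (fst (e n) - fst l)" for n
        using add[of "fst (e n)" "(- 1) *\<^sub>R fst l"] scale[of "fst l" "-1"] eK lK K subspace_neg[of K "fst l"]
        by simp
      then show "\<forall>\<^sub>F n in sequentially. norm (f (fst (e n)) - f (fst l)) \<le> c * norm (fst (e n) - fst l)"
        using bound eK lK K by (simp add: subspace_diff)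
      have "(\<lambda>n. c * norm (fst (e n) - fst l)) \<longlonglongrightarrow> c * norm (fst l - fst l)"
        by (intro tendsto_intros w)
      then show "(\<lambda>n. c * norm (fst (e n) - fst l)) \<longlonglongrightarrow> 0" by simp
    qed
    then have "(\<lambda>n. f (fst (e n))) \<longlonglongrightarrow> f (fst l)" by (rule LIM_zero_cancel)
    then have "- f (fst l) \<le> snd l"
      using tendsto_le[OF sequentially_bot t tendsto_minus] eK by simp
    then show "l \<in> S" using lK by (cases l) (auto simp: S_def)
  qed
  have lb: "- c\<^sup>2 / 2 \<le> t + (norm w)\<^sup>2 / 2" if "(w, t) \<in> S" for w t
  proof -
    have "- f w \<le> t" "\<bar>f w\<bar> \<le> c * norm w" using that bound by (auto simp: S_def)
    moreover have "0 \<le> (norm w - c)\<^sup>2" by simp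
    ultimately show ?thesis by (simp add: power2_diff mult.commute)
  qed
  obtain w0 t0 where w0: "(w0, t0) \<in> S"
    and min: "\<And>w t. (w, t) \<in> S \<Longrightarrow> t0 \<le> t + w0 \<bullet> (w - w0)"
    using convex_epigraph_minimizer[OF ne cv cl lb] by blast
  have w0K: "w0 \<in> K" and t0: "- f w0 \<le> t0" using w0 by (auto simp: S_def)
  have le: "f h \<le> w0 \<bullet> h" if "h \<in> K" for h
    using min[of "w0 + h" "- f (w0 + h)"] that w0K t0 K add[of w0 h]
    by (simp add: S_def subspace_add)
  have "f h = w0 \<bullet> h" if "h \<in> K" for h
    using le[OF that] le[of "- h"] scale[OF that, of "-1"] that K by (simp add: subspace_neg)
  with w0K show thesis by (rule that)
qed

text \<open>
  The constant \<^const>\<open>adjoint\<close> chooses some adjoint; Riesz provides one.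
\<close>

lemma adjoint_bounded_linear:
  fixes f :: "'a::{real_inner,complete_space} \<Rightarrow> 'b::real_inner"
  assumes "bounded_linear f"
  shows "x \<bullet> adjoint f y = f x \<bullet> y"
proof -
  interpret bounded_linear f by fact
  have "\<exists>l. \<forall>u. f u \<bullet> y = l \<bullet> u" for y
  proof -
    have "\<bar>f u \<bullet> y\<bar> \<le> (onorm f * norm y) * norm u" for u
    proof -
      have "\<bar>f u \<bullet> y\<bar> \<le> norm (f u) * norm y" by (rule Cauchy_Schwarz_ineq2)
      also have "\<dots> \<le> (onorm f * norm u) * norm y"
        using onorm[OF assms] by (intro mult_right_mono) auto
      finally show ?thesis by (simp add: algebra_simps)
    qed
    then show ?thesis
      using riesz_representation_on[of UNIV "\<lambda>u. f u \<bullet> y"]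
      by (metis UNIV_I add closed_UNIV inner_add_left inner_scaleR_left scale subspace_UNIV)
  qed
  then have "\<exists>g. \<forall>y u. f u \<bullet> y = u \<bullet> g y" by (metis inner_commute)
  then have "\<exists>g. \<forall>x y. f x \<bullet> y = x \<bullet> g y" by blast
  from someI_ex[OF this, folded adjoint_def] show ?thesis by metis
qed

text \<open>
  Otherwise adding \<open>(x, u)\<close> to the graph would give a larger monotone operator.
\<close>

lemma maximally_monotone_onD:
  assumes "maximally_monotone_on K M" "x \<in> K" "u \<in> K"
    and "\<And>y w. w \<in> M y \<Longrightarrow> (x - y) \<bullet> (u - w) \<ge> 0"
  shows "u \<in> M x"
proof (rule ccontr)
  assume nu: "u \<notin> M x"
  define N where "N = M(x := insert u (M x))"
  have N: "gra N = insert (x, u) (gra M)" by (auto simp: N_def gra_def split: if_splits)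
  have "operator_on K N" using assms(1-3) N by (auto simp: maximally_monotone_on_def operator_on_def)
  moreover have "monotone_op N"
  proof -
    have "(y - x) \<bullet> (w - u) \<ge> 0" if "w \<in> M y" for y w
      using assms(4)[OF that] inner_minus_left[of "x - y" "u - w"] inner_minus_right
      by (smt (verit, best) inner_diff_left inner_diff_right)
    then show ?thesis
      using assms(1,4) unfolding monotone_op_def N maximally_monotone_on_def by (auto simp: gra_def)
  qed
  moreover have "gra M \<subset> gra N" using nu N by (auto simp: gra_def)
  ultimately show False using assms(1) by (auto simp: maximally_monotone_on_def)
qed

text \<open>
  The set \<open>S\<close> is the epigraph of the Fitzpatrick function
  \<open>F (x, u) = sup {x \<bullet> b + a \<bullet> u - a \<bullet> b | (a, b) \<in> gra M}\<close>, which maximality of \<open>M\<close> bounds below by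
  \<open>x \<bullet> u\<close>. Hence \<open>F (x, u) + (\<parallel>x\<parallel>\<^sup>2 + \<parallel>u\<parallel>\<^sup>2) / 2\<close> is nonnegative and has a minimizer \<open>(x0, u0)\<close>. Its
  optimality condition at the points of the graph of \<open>M\<close>, where \<open>F (a, b) = a \<bullet> b\<close>, shows that
  \<open>(- u0, - x0)\<close> is monotonically related to that graph; so it belongs to it, and the same
  inequality at this point forces \<open>x0 + u0 = 0\<close>.
\<close>

lemma minty_zero:
  fixes K :: "'a::{real_inner,complete_space} set"
  assumes K: "subspace K" "closed K" and M: "maximally_monotone_on K M"
  obtains x where "x \<in> K" "- x \<in> M x"
proof -
  have on: "x \<in> K" "u \<in> K" if "u \<in> M x" for x u
    using M that by (auto simp: maximally_monotone_on_def operator_on_def gra_def)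
  have mono: "(x - y) \<bullet> (u - w) \<ge> 0" if "u \<in> M x" "w \<in> M y" for x y u w
    using M that by (force simp: maximally_monotone_on_def monotone_op_def gra_def)
  define S where "S = {p. fst (fst p) \<in> K \<and> snd (fst p) \<in> K \<and>
    (\<forall>(a, b) \<in> gra M. fst (fst p) \<bullet> b + a \<bullet> snd (fst p) - a \<bullet> b \<le> snd p)}"
  have S: "((x, u), t) \<in> S \<longleftrightarrow> x \<in> K \<and> u \<in> K \<and> (\<forall>a b. b \<in> M a \<longrightarrow> x \<bullet> b + a \<bullet> u - a \<bullet> b \<le> t)" for x u t
    by (auto simp: S_def gra_def)
  have "\<exists>a b. b \<in> M a"
  proof (rule ccontr)
    assume "\<not> (\<exists>a b. b \<in> M a)"
    then have "0 \<in> M 0" using K by (intro maximally_monotone_onD[OF M]) (auto simp: subspace_0)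
    then show False using \<open>\<not> _\<close> by blast
  qed
  then obtain a b where ab: "b \<in> M a" by blast
  have "((a, b), a \<bullet> b) \<in> S"
    unfolding S
  proof (intro conjI allI impI)
    fix a' b' assume "b' \<in> M a'"
    from mono[OF ab this] show "a \<bullet> b' + a' \<bullet> b - a' \<bullet> b' \<le> a \<bullet> b"
      by (simp add: inner_diff_left inner_diff_right)
  qed (use on ab in auto)
  then have ne: "S \<noteq> {}" by blast
  have cv: "convex S"
    unfolding convex_alt
  proof (intro ballI allI impI)
    fix p q :: "('a \<times> 'a) \<times> real" and s :: real assume pq: "p \<in> S" "q \<in> S" and s: "0 \<le> s \<and> s \<le> 1"
    obtain x u t x' u' t' where [simp]: "p = ((x, u), t)" "q = ((x', u'), t')"
      by (metis prod.collapse)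
    have "((1 - s) *\<^sub>R x + s *\<^sub>R x') \<bullet> b + a \<bullet> ((1 - s) *\<^sub>R u + s *\<^sub>R u') - a \<bullet> b \<le> (1 - s) * t + s * t'"
      if "b \<in> M a" for a b
    proof -
      have "(1 - s) * (x \<bullet> b + a \<bullet> u - a \<bullet> b) + s * (x' \<bullet> b + a \<bullet> u' - a \<bullet> b) \<le> (1 - s) * t + s * t'"
        using pq that s by (intro add_mono mult_left_mono) (auto simp: S)
      then show ?thesis by (simp add: algebra_simps)
    qed
    then show "(1 - s) *\<^sub>R p + s *\<^sub>R q \<in> S"
      using pq K by (auto simp: S subspace_add subspace_scale)
  qed
  have cl: "closed S"
  proof -
    have "S = (\<lambda>p. fst (fst p)) -` K \<inter> (\<lambda>p. snd (fst p)) -` K \<inter>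
      (\<Inter>(a, b) \<in> gra M. {p. fst (fst p) \<bullet> b + a \<bullet> snd (fst p) - a \<bullet> b \<le> snd p})"
      by (auto simp: S_def)
    also have "closed \<dots>"
      by (intro closed_Int closed_INT closed_vimage K ballI)
         (auto intro!: closed_Collect_le continuous_intros)
    finally show ?thesis .
  qed
  have fitz: "x \<bullet> u \<le> t" if xut: "((x, u), t) \<in> S" for x u t
  proof (cases "u \<in> M x")
    case True
    then have "x \<bullet> u + x \<bullet> u - x \<bullet> u \<le> t" using that unfolding S by blast
    then show ?thesis by simp
  next
    case False
    then obtain a b where ab: "b \<in> M a" "(x - a) \<bullet> (u - b) < 0"
      using maximally_monotone_onD[OF M, of x u] xut False unfolding S by (meson not_le)
    then have "x \<bullet> b + a \<bullet> u - a \<bullet> b \<le> t" using that by (auto simp: S)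
    with ab(2) show ?thesis by (simp add: inner_diff_left inner_diff_right)
  qed
  have nsq: "(norm (x + u))\<^sup>2 = (norm x)\<^sup>2 + 2 * (x \<bullet> u) + (norm u)\<^sup>2" for x u :: 'a
    by (simp add: power2_norm_eq_inner inner_add_left inner_add_right inner_commute)
  have lb: "0 \<le> t + (norm w)\<^sup>2 / 2" if "(w, t) \<in> S" for w t
  proof -
    obtain x u where [simp]: "w = (x, u)" by (cases w)
    have "0 \<le> (norm (x + u))\<^sup>2" by simp
    then show ?thesis using fitz[of x u t] that unfolding nsq by (simp add: norm_Pair field_simps)
  qed
  obtain w0 t0 where w0S: "(w0, t0) \<in> S"
    and min: "\<And>w t. (w, t) \<in> S \<Longrightarrow> t0 \<le> t + w0 \<bullet> (w - w0)"
    using convex_epigraph_minimizer[OF ne cv cl lb] by blast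
  obtain x0 u0 where w0: "w0 = (x0, u0)" by (cases w0)
  have K0: "x0 \<in> K" "u0 \<in> K" and t0: "x0 \<bullet> u0 \<le> t0" using w0S fitz by (auto simp: w0 S)
  have key: "(norm (x0 + u0))\<^sup>2 \<le> (- u0 - a) \<bullet> (- x0 - b)" if "b \<in> M a" for a b
  proof -
    have "((a, b), a \<bullet> b) \<in> S"
      unfolding S
    proof (intro conjI allI impI)
      fix a' b' assume "b' \<in> M a'"
      from mono[OF that this] show "a \<bullet> b' + a' \<bullet> b - a' \<bullet> b' \<le> a \<bullet> b"
        by (simp add: inner_diff_left inner_diff_right)
    qed (use on that in auto)
    from min[OF this] t0 show ?thesis
      unfolding w0 power2_norm_eq_inner
      by (simp add: inner_diff_left inner_diff_right inner_add_left inner_add_right inner_commute)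
  qed
  have "- x0 \<in> M (- u0)"
  proof (rule maximally_monotone_onD[OF M])
    fix a b assume "b \<in> M a"
    from key[OF this] show "0 \<le> (- u0 - a) \<bullet> (- x0 - b)" by (rule order_trans[rotated]) simp
  qed (use K0 K subspace_neg in auto)
  from key[OF this] have "x0 + u0 = 0" by simp
  then have "- u0 = x0" using minus_unique[of u0 x0] by (simp add: add.commute)
  with \<open>- x0 \<in> M (- u0)\<close> show thesis using that[of x0] K0 by simp
qed

section \<open>Resolvents and maximality\<close>

lemma maximally_monotone_onI:
  assumes "operator_on K M" "monotone_op M"
    and "\<And>x u. x \<in> K \<Longrightarrow> u \<in> K \<Longrightarrow> (\<And>y w. w \<in> M y \<Longrightarrow> (x - y) \<bullet> (u - w) \<ge> 0) \<Longrightarrow> u \<in> M x"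
  shows "maximally_monotone_on K M"
  unfolding maximally_monotone_on_def
proof (intro conjI assms(1,2) notI)
  assume "\<exists>N. operator_on K N \<and> monotone_op N \<and> gra M \<subset> gra N"
  then obtain N where N: "operator_on K N" "monotone_op N" "gra M \<subset> gra N" by blast
  then obtain x u where xu: "u \<in> N x" "u \<notin> M x" by (auto simp: gra_def)
  have "u \<in> M x"
  proof (rule assms(3))
    show "x \<in> K" "u \<in> K" using N(1) xu by (auto simp: operator_on_def gra_def)
    fix y w assume "w \<in> M y"
    then have "w \<in> N y" using N(3) by (auto simp: gra_def)
    with N(2) xu show "(x - y) \<bullet> (u - w) \<ge> 0" by (auto simp: monotone_op_def gra_def)
  qed
  with xu show False by blast
qed

lemma operator_onD: "operator_on K M \<Longrightarrow> u \<in> M x \<Longrightarrow> x \<in> K \<and> u \<in> K"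
  by (auto simp: operator_on_def gra_def)

lemma monotone_opD: "monotone_op M \<Longrightarrow> u \<in> M x \<Longrightarrow> w \<in> M y \<Longrightarrow> (x - y) \<bullet> (u - w) \<ge> 0"
  by (force simp: monotone_op_def gra_def)

lemma monotone_opI:
  "(\<And>x y u w. u \<in> M x \<Longrightarrow> w \<in> M y \<Longrightarrow> (x - y) \<bullet> (u - w) \<ge> 0) \<Longrightarrow> monotone_op M"
  by (auto simp: monotone_op_def gra_def)

lemma maximally_monotone_on_op_inverse:
  assumes "maximally_monotone_on K M"
  shows "maximally_monotone_on K (op_inverse M)"
proof (rule maximally_monotone_onI)
  show "operator_on K (op_inverse M)"
    using assms by (auto simp: maximally_monotone_on_def operator_on_def gra_def op_inverse_def)
  have "monotone_op M" using assms by (simp add: maximally_monotone_on_def)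
  then show "monotone_op (op_inverse M)"
    by (intro monotone_opI) (metis inner_commute mem_Collect_eq monotone_opD op_inverse_def)
  fix x u assume "x \<in> K" "u \<in> K" "\<And>y w. w \<in> op_inverse M y \<Longrightarrow> (x - y) \<bullet> (u - w) \<ge> 0"
  then have "x \<in> M u"
    by (intro maximally_monotone_onD[OF assms]) (simp_all add: op_inverse_def inner_commute)
  then show "u \<in> op_inverse M x" by (simp add: op_inverse_def)
qed

lemma maximally_monotone_on_affine:
  assumes K: "subspace K" and M: "maximally_monotone_on K M" and "c \<in> K" and \<gamma>: "\<gamma> > 0"
  shows "maximally_monotone_on K (\<lambda>x. (\<lambda>u. \<gamma> *\<^sub>R u + c) ` M x)"
proof (rule maximally_monotone_onI)
  have on: "operator_on K M" and mono: "monotone_op M"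
    using M by (auto simp: maximally_monotone_on_def)
  show "operator_on K (\<lambda>x. (\<lambda>u. \<gamma> *\<^sub>R u + c) ` M x)"
    using operator_onD[OF on] K \<open>c \<in> K\<close>
    by (auto simp: operator_on_def gra_def subspace_add subspace_scale)
  have "(x - y) \<bullet> ((\<gamma> *\<^sub>R u + c) - (\<gamma> *\<^sub>R w + c)) \<ge> 0" if "u \<in> M x" "w \<in> M y" for x y u w
    using monotone_opD[OF mono that] \<gamma> by (simp flip: scaleR_diff_right)
  then show "monotone_op (\<lambda>x. (\<lambda>u. \<gamma> *\<^sub>R u + c) ` M x)"
    by (intro monotone_opI) auto
  fix x u assume xu: "x \<in> K" "u \<in> K"
    and rel: "\<And>y w. w \<in> (\<lambda>u. \<gamma> *\<^sub>R u + c) ` M y \<Longrightarrow> (x - y) \<bullet> (u - w) \<ge> 0"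
  have "(1 / \<gamma>) *\<^sub>R (u - c) \<in> M x"
  proof (rule maximally_monotone_onD[OF M])
    show "(1 / \<gamma>) *\<^sub>R (u - c) \<in> K" using xu K \<open>c \<in> K\<close> by (simp add: subspace_diff subspace_scale)
    fix y w assume "w \<in> M y"
    then have "(x - y) \<bullet> (u - (\<gamma> *\<^sub>R w + c)) \<ge> 0" by (intro rel) auto
    also have "u - (\<gamma> *\<^sub>R w + c) = \<gamma> *\<^sub>R ((1 / \<gamma>) *\<^sub>R (u - c) - w)"
      using \<gamma> by (simp add: scaleR_diff_right)
    finally show "(x - y) \<bullet> ((1 / \<gamma>) *\<^sub>R (u - c) - w) \<ge> 0"
      using \<gamma> by (simp add: zero_le_mult_iff)
  qed (rule xu)
  moreover have "\<gamma> *\<^sub>R (1 / \<gamma>) *\<^sub>R (u - c) + c = u" using \<gamma> by simp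
  ultimately show "u \<in> (\<lambda>u. \<gamma> *\<^sub>R u + c) ` M x" by (metis image_eqI)
qed

text \<open>
  Minty's theorem for the operator \<open>\<gamma> M - y\<close>.
\<close>

lemma minty_surjective:
  fixes K :: "'a::{real_inner,complete_space} set"
  assumes K: "subspace K" "closed K" and M: "maximally_monotone_on K M"
    and \<gamma>: "\<gamma> > 0" and y: "y \<in> K"
  shows "\<exists>p u. u \<in> M p \<and> p + \<gamma> *\<^sub>R u = y"
proof -
  have "maximally_monotone_on K (\<lambda>x. (\<lambda>u. \<gamma> *\<^sub>R u + (- y)) ` M x)"
    using K y by (intro maximally_monotone_on_affine M \<gamma>) (auto simp: subspace_neg)
  from minty_zero[OF K this] obtain p where "- p \<in> (\<lambda>u. \<gamma> *\<^sub>R u + (- y)) ` M p" by blast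
  then show ?thesis by (force simp: algebra_simps)
qed

text \<open>
  Monotonicity bounds the squared left side by the inner product of the two differences; then
  Cauchy-Schwarz applies.
\<close>

lemma resolvent_nonexpansive:
  assumes "monotone_op M" "u \<in> M p" "u' \<in> M p'" "\<gamma> > 0"
  shows "norm (p - p') \<le> norm ((p + \<gamma> *\<^sub>R u) - (p' + \<gamma> *\<^sub>R u'))"
proof (cases "p = p'")
  case False
  have "0 \<le> \<gamma> * ((p - p') \<bullet> (u - u'))"
    using monotone_opD[OF assms(1-3)] assms(4) by simp
  then have "(norm (p - p'))\<^sup>2 \<le> (p - p') \<bullet> ((p + \<gamma> *\<^sub>R u) - (p' + \<gamma> *\<^sub>R u'))"
    by (simp add: power2_norm_eq_inner inner_diff_right inner_add_right algebra_simps)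
  also have "\<dots> \<le> norm (p - p') * norm ((p + \<gamma> *\<^sub>R u) - (p' + \<gamma> *\<^sub>R u'))"
    by (rule norm_cauchy_schwarz)
  finally show ?thesis using False by (simp add: power2_eq_square)
qed simp

text \<open>
  Existence is Minty's theorem, uniqueness is nonexpansiveness; together they make
  \<^const>\<open>the_elem\<close> meaningful on the values of the resolvent.
\<close>

lemma the_elem_resolvent:
  fixes K :: "'a::{real_inner,complete_space} set"
  assumes K: "subspace K" "closed K" and M: "maximally_monotone_on K M"
    and \<gamma>: "\<gamma> > 0" and y: "y \<in> K"
  obtains u where "u \<in> M (the_elem (resolvent (scale_op \<gamma> M) y))"
    "the_elem (resolvent (scale_op \<gamma> M) y) + \<gamma> *\<^sub>R u = y"
proof -
  have mono: "monotone_op M" using M by (auto simp: maximally_monotone_on_def)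
  have iff: "p \<in> resolvent (scale_op \<gamma> M) y \<longleftrightarrow> (\<exists>u\<in>M p. y = p + \<gamma> *\<^sub>R u)" for p
    by (auto simp: resolvent_def op_inverse_def scale_op_def set_plus_def)
  obtain p u where pu: "u \<in> M p" "p + \<gamma> *\<^sub>R u = y" using minty_surjective[OF assms] by blast
  have "q = p" if q: "q \<in> resolvent (scale_op \<gamma> M) y" for q
  proof -
    obtain u' where u': "u' \<in> M q" "y = q + \<gamma> *\<^sub>R u'" using q iff by blast
    have "norm (q - p) \<le> norm (y - y)"
      using resolvent_nonexpansive[OF mono u'(1) pu(1) \<gamma>] unfolding pu(2) u'(2)[symmetric] .
    then show ?thesis by simp
  qed
  then have "resolvent (scale_op \<gamma> M) y = {p}" using pu iff by blast
  then show thesis using that pu by simp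
qed

text \<open>
  This is the maximality of \<open>M + Q\<close>, tested at the pair \<open>(x, 0)\<close>. For a small step size \<open>\<delta>\<close> the map
  \<open>\<xi> \<mapsto> J (x - \<delta> Q \<xi>)\<close>, with \<open>J\<close> the resolvent of \<open>\<delta> M\<close>, is a contraction. Its fixed point \<open>p\<close> satisfies
  \<open>x - p = \<delta> (u + Q p)\<close> for some \<open>u \<in> M p\<close>, and then the assumed relation gives
  \<open>- \<delta> \<parallel>u + Q p\<parallel>\<^sup>2 \<ge> 0\<close>.
\<close>

lemma zero_if_monotonically_related:
  fixes K :: "'a::{real_inner,complete_space} set"
  assumes K: "subspace K" "closed K" and on: "operator_on K M" and mono: "monotone_op M"
    and surj: "\<And>\<gamma> y. \<gamma> > 0 \<Longrightarrow> y \<in> K \<Longrightarrow> \<exists>p u. u \<in> M p \<and> p + \<gamma> *\<^sub>R u = y"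
    and QK: "\<And>y. y \<in> K \<Longrightarrow> Q y \<in> K" and lip: "\<beta>-lipschitz_on K Q"
    and x: "x \<in> K" and rel: "\<And>y w. w \<in> M y \<Longrightarrow> (x - y) \<bullet> (- (w + Q y)) \<ge> 0"
  shows "- Q x \<in> M x"
proof -
  have \<beta>: "\<beta> \<ge> 0" using lip by (rule lipschitz_on_nonneg)
  define \<delta> where "\<delta> = 1 / (\<beta> + 1)"
  have \<delta>: "\<delta> > 0" "\<delta> * \<beta> < 1" "\<delta> * \<beta> \<ge> 0" using \<beta> by (auto simp: \<delta>_def)
  obtain J V where J: "\<And>y. y \<in> K \<Longrightarrow> V y \<in> M (J y) \<and> J y + \<delta> *\<^sub>R V y = y"
    using surj[OF \<delta>(1)] by metis
  have arg: "x - \<delta> *\<^sub>R Q \<xi> \<in> K" if "\<xi> \<in> K" for \<xi>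
    using that K x QK by (simp add: subspace_diff subspace_scale)
  define F where "F = (\<lambda>\<xi>. J (x - \<delta> *\<^sub>R Q \<xi>))"
  have "\<exists>!p\<in>K. F p = p"
  proof (rule Banach_fix)
    show "complete K" using K by (simp add: complete_eq_closed)
    show "K \<noteq> {}" using x by auto
    show "F ` K \<subseteq> K" using J[OF arg] operator_onD[OF on] by (auto simp: F_def)
    fix \<xi> \<eta> assume k: "\<xi> \<in> K" "\<eta> \<in> K"
    have "dist (F \<xi>) (F \<eta>) \<le> norm ((x - \<delta> *\<^sub>R Q \<xi>) - (x - \<delta> *\<^sub>R Q \<eta>))"
      using resolvent_nonexpansive[OF mono _ _ \<delta>(1)] J[OF arg[OF k(1)]] J[OF arg[OF k(2)]]
      unfolding F_def dist_norm by metis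
    also have "(x - \<delta> *\<^sub>R Q \<xi>) - (x - \<delta> *\<^sub>R Q \<eta>) = \<delta> *\<^sub>R (Q \<eta> - Q \<xi>)"
      by (simp add: scaleR_diff_right)
    also have "norm \<dots> = \<delta> * dist (Q \<xi>) (Q \<eta>)"
      using \<delta> by (simp add: dist_norm norm_minus_commute)
    also have "\<dots> \<le> \<delta> * (\<beta> * dist \<xi> \<eta>)"
      using \<delta> lipschitz_onD[OF lip k] by (intro mult_left_mono) auto
    finally show "dist (F \<xi>) (F \<eta>) \<le> \<delta> * \<beta> * dist \<xi> \<eta>" by (simp add: mult.assoc)
  qed (use \<delta> in auto)
  then obtain p where p: "p \<in> K" "F p = p" by blast
  define u where "u = V (x - \<delta> *\<^sub>R Q p)"
  have u: "u \<in> M p" "p + \<delta> *\<^sub>R u = x - \<delta> *\<^sub>R Q p"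
    using J[OF arg[OF p(1)]] p(2) by (auto simp: F_def u_def)
  then have eq: "x - p = \<delta> *\<^sub>R (u + Q p)" by (simp add: algebra_simps)
  have "0 \<le> \<delta> *\<^sub>R (u + Q p) \<bullet> (- (u + Q p))" using rel[OF u(1)] unfolding eq .
  then have "0 \<le> \<delta> * - ((u + Q p) \<bullet> (u + Q p))"
    by (simp only: inner_scaleR_left inner_minus_right)
  then have "(u + Q p) \<bullet> (u + Q p) \<le> 0"
    using \<delta>(1) by (simp only: zero_le_mult_iff) simp
  then have z: "u + Q p = 0" by (metis inner_eq_zero_iff inner_ge_zero order_antisym)
  with eq have "x = p" by simp
  with z u(1) show ?thesis by (metis add.commute minus_unique)
qed

section \<open>Weak convergence\<close>

text \<open>
  A diagonal argument yields a subsequence whose inner products with all the \<open>s k\<close> converge. The set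
  \<open>S\<close> of those \<open>w\<close> in \<open>K\<close> for which the inner products converge is a closed subspace that contains the sequence;
  on \<open>S\<close> the limit is a bounded functional, represented by some \<open>l\<close>. For the other \<open>w\<close> one passes to
  the orthogonal projection on \<open>S\<close>.
\<close>

lemma bounded_weakly_convergent_subsequence:
  fixes K :: "'a::{real_inner,complete_space} set"
  assumes K: "subspace K" "closed K" and sK: "\<And>n. s n \<in> K" and R: "\<And>n. norm (s n) \<le> R"
  obtains l \<sigma> where "l \<in> K" "strict_mono (\<sigma> :: nat \<Rightarrow> nat)" "weakly_converges_on UNIV (s \<circ> \<sigma>) l"
proof -
  have R0: "R \<ge> 0" using R[of 0] norm_ge_zero order_trans by blast
  have "norm (s n \<bullet> s k) \<le> R * R" for n k
    using Cauchy_Schwarz_ineq2[of "s n" "s k"] mult_mono[OF R[of n] R[of k]] R0 by auto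
  then obtain \<sigma> where \<sigma>: "strict_mono (\<sigma> :: nat \<Rightarrow> nat)"
    and conv: "\<And>k. \<exists>l. (\<lambda>n. s (\<sigma> n) \<bullet> s k) \<longlonglongrightarrow> l"
    using function_convergent_subsequence[of "UNIV :: nat set" "\<lambda>n k. s n \<bullet> s k" "R * R"]
    by (metis UNIV_I countableI_type)
  define S where "S = {w \<in> K. convergent (\<lambda>n. s (\<sigma> n) \<bullet> w)}"
  have "subspace S"
    using K unfolding S_def subspace_def
    by (auto simp: inner_add_right convergent_const intro: convergent_add convergent_mult)
  have "closed S"
    unfolding closed_sequential_limits
  proof (intro allI impI)
    fix e l assume e: "(\<forall>n. e n \<in> S) \<and> e \<longlonglongrightarrow> l"
    then have lK: "l \<in> K" using closed_sequentially[OF K(2), of e l] by (auto simp: S_def)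
    have "Cauchy (\<lambda>n. s (\<sigma> n) \<bullet> l)"
    proof (rule metric_CauchyI)
      fix d :: real assume d: "d > 0"
      define d' where "d' = d / (3 * (R + 1))"
      have d': "d' > 0" "R * d' < d / 3" using d R0 by (auto simp: d'_def field_simps)
      obtain k where k: "norm (l - e k) < d'"
        using e d'(1) unfolding LIMSEQ_iff by (metis norm_minus_commute order_refl)
      have small: "\<bar>s n \<bullet> (l - e k)\<bar> < d / 3" for n
      proof -
        have "\<bar>s n \<bullet> (l - e k)\<bar> \<le> norm (s n) * norm (l - e k)" by (rule Cauchy_Schwarz_ineq2)
        also have "\<dots> \<le> R * d'" using R k R0 by (intro mult_mono) auto
        finally show ?thesis using d' by simp
      qed
      have "Cauchy (\<lambda>n. s (\<sigma> n) \<bullet> e k)"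
        using e by (intro convergent_Cauchy) (auto simp: S_def)
      from metric_CauchyD[OF this, of "d / 3"] d
      obtain N where N: "\<forall>m\<ge>N. \<forall>n\<ge>N. dist (s (\<sigma> m) \<bullet> e k) (s (\<sigma> n) \<bullet> e k) < d / 3" by auto
      have "dist (s (\<sigma> m) \<bullet> l) (s (\<sigma> n) \<bullet> l) < d" if "m \<ge> N" "n \<ge> N" for m n
      proof -
        have "\<bar>s (\<sigma> m) \<bullet> e k - s (\<sigma> n) \<bullet> e k\<bar> < d / 3"
          using N that by (simp add: dist_real_def)
        then show ?thesis
          using small[of "\<sigma> m"] small[of "\<sigma> n"]
          unfolding dist_real_def inner_diff_right by linarith
      qed
      then show "\<exists>N. \<forall>m\<ge>N. \<forall>n\<ge>N. dist (s (\<sigma> m) \<bullet> l) (s (\<sigma> n) \<bullet> l) < d" by blast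
    qed
    then show "l \<in> S" using lK by (simp add: S_def Cauchy_convergent)
  qed
  have sS: "s k \<in> S" for k using conv sK by (auto simp: S_def convergent_def)
  define f where "f = (\<lambda>w. lim (\<lambda>n. s (\<sigma> n) \<bullet> w))"
  have f: "(\<lambda>n. s (\<sigma> n) \<bullet> w) \<longlonglongrightarrow> f w" if "w \<in> S" for w
    using that by (simp add: S_def f_def convergent_LIMSEQ_iff)
  obtain l where l: "l \<in> S" "\<And>w. w \<in> S \<Longrightarrow> f w = l \<bullet> w"
  proof (rule riesz_representation_on[OF \<open>subspace S\<close> \<open>closed S\<close>, of f R])
    fix u v assume uv: "u \<in> S" "v \<in> S"
    have "(\<lambda>n. s (\<sigma> n) \<bullet> (u + v)) \<longlonglongrightarrow> f u + f v"
      using tendsto_add[OF f[OF uv(1)] f[OF uv(2)]] by (simp add: inner_add_right)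
    then show "f (u + v) = f u + f v"
      using f uv \<open>subspace S\<close> LIMSEQ_unique subspace_add by blast
  next
    fix c u assume u: "u \<in> S"
    have "(\<lambda>n. s (\<sigma> n) \<bullet> (c *\<^sub>R u)) \<longlonglongrightarrow> c * f u"
      using tendsto_mult[OF tendsto_const f[OF u]] by simp
    then show "f (c *\<^sub>R u) = c * f u"
      using f u \<open>subspace S\<close> LIMSEQ_unique subspace_scale by blast
  next
    fix u assume u: "u \<in> S"
    have "\<bar>s (\<sigma> n) \<bullet> u\<bar> \<le> R * norm u" for n
      using Cauchy_Schwarz_ineq2[of "s (\<sigma> n)" u] mult_right_mono[OF R[of "\<sigma> n"], of "norm u"] by simp
    then show "\<bar>f u\<bar> \<le> R * norm u"
      using tendsto_rabs[OF f[OF u]] by (intro LIMSEQ_le_const2) auto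
  qed blast
  have "(\<lambda>n. s (\<sigma> n) \<bullet> w) \<longlonglongrightarrow> l \<bullet> w" for w
  proof -
    obtain w' where w': "w' \<in> S" "\<And>u. u \<in> S \<Longrightarrow> w \<bullet> u = w' \<bullet> u"
      using riesz_representation_on[OF \<open>subspace S\<close> \<open>closed S\<close>, of "\<lambda>u. w \<bullet> u" "norm w"]
        Cauchy_Schwarz_ineq2 by (metis inner_add_right inner_scaleR_right)
    have "(\<lambda>n. s (\<sigma> n) \<bullet> w') \<longlonglongrightarrow> l \<bullet> w'" using f l w' by metis
    moreover have "u \<bullet> w = u \<bullet> w'" if "u \<in> S" for u
      using w'(2)[OF that] by (simp add: inner_commute)
    ultimately show ?thesis using sS l(1) by simp
  qed
  then have "weakly_converges_on UNIV (s \<circ> \<sigma>) l" by (simp add: weakly_converges_on_def)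
  with \<sigma> l(1) show thesis using that unfolding S_def by blast
qed

text \<open>
  Two weak cluster points \<open>l\<close> and \<open>l'\<close> coincide: since \<open>\<parallel>s n - l\<parallel>\<close> and \<open>\<parallel>s n - l'\<parallel>\<close> converge, so does
  \<open>s n \<bullet> (l - l')\<close>, and its limit is both \<open>l \<bullet> (l - l')\<close> and \<open>l' \<bullet> (l - l')\<close>. A bounded sequence with
  a single weak cluster point converges weakly.
\<close>

lemma opial:
  fixes K :: "'a::{real_inner,complete_space} set"
  assumes K: "subspace K" "closed K" and sK: "\<And>n. s n \<in> K" and "Z \<noteq> {}"
    and fejer: "\<And>z. z \<in> Z \<Longrightarrow> convergent (\<lambda>n. norm (s n - z))"
    and cluster: "\<And>\<sigma> l. strict_mono (\<sigma> :: nat \<Rightarrow> nat) \<Longrightarrow> l \<in> K \<Longrightarrow>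
      weakly_converges_on UNIV (s \<circ> \<sigma>) l \<Longrightarrow> l \<in> Z"
  obtains l where "l \<in> Z" "weakly_converges_on UNIV s l"
proof -
  obtain z where "z \<in> Z" using \<open>Z \<noteq> {}\<close> by blast
  from fejer[OF this] have "Bseq (\<lambda>n. norm (s n - z))" by (rule convergent_imp_Bseq)
  then obtain R where R: "norm (s n - z) \<le> R" for n by (auto simp: Bseq_def)
  have R': "norm (s n) \<le> R + norm z" for n
    using R[of n] norm_triangle_sub[of "s n" z] by simp
  have uniq: "l = l'"
    if h: "strict_mono \<sigma>" "weakly_converges_on UNIV (s \<circ> \<sigma>) l" "l \<in> Z"
       "strict_mono \<sigma>'" "weakly_converges_on UNIV (s \<circ> \<sigma>') l'" "l' \<in> Z" for \<sigma> \<sigma>' :: "nat \<Rightarrow> nat" and l l'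
  proof -
    have eq: "s n \<bullet> (l - l')
        = ((norm (s n - l'))\<^sup>2 - (norm (s n - l))\<^sup>2 + (norm l)\<^sup>2 - (norm l')\<^sup>2) / 2" for n
      by (simp add: power2_norm_eq_inner inner_diff_left inner_diff_right inner_commute)
    obtain \<alpha> \<alpha>' where lims: "(\<lambda>n. norm (s n - l)) \<longlonglongrightarrow> \<alpha>" "(\<lambda>n. norm (s n - l')) \<longlonglongrightarrow> \<alpha>'"
      using fejer h unfolding convergent_def by blast
    define c where "c = (\<alpha>'\<^sup>2 - \<alpha>\<^sup>2 + (norm l)\<^sup>2 - (norm l')\<^sup>2) / 2"
    have c: "(\<lambda>n. s n \<bullet> (l - l')) \<longlonglongrightarrow> c"
      unfolding eq c_def by (intro tendsto_intros lims) auto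
    have "(\<lambda>n. s (\<sigma> n) \<bullet> (l - l')) \<longlonglongrightarrow> c" "(\<lambda>n. s (\<sigma>' n) \<bullet> (l - l')) \<longlonglongrightarrow> c"
      using LIMSEQ_subseq_LIMSEQ[OF c h(1)] LIMSEQ_subseq_LIMSEQ[OF c h(4)] by (auto simp: o_def)
    moreover have "(\<lambda>n. s (\<sigma> n) \<bullet> (l - l')) \<longlonglongrightarrow> l \<bullet> (l - l')"
      "(\<lambda>n. s (\<sigma>' n) \<bullet> (l - l')) \<longlonglongrightarrow> l' \<bullet> (l - l')"
      using h unfolding weakly_converges_on_def by auto
    ultimately have "l \<bullet> (l - l') = l' \<bullet> (l - l')" using LIMSEQ_unique by metis
    then have "(l - l') \<bullet> (l - l') = 0" by (simp add: inner_diff_left)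
    then show ?thesis by simp
  qed
  obtain l \<sigma> where l: "l \<in> K" "strict_mono (\<sigma> :: nat \<Rightarrow> nat)" "weakly_converges_on UNIV (s \<circ> \<sigma>) l"
    by (rule bounded_weakly_convergent_subsequence[OF K sK R'])
  have lZ: "l \<in> Z" using cluster l by blast
  have "(\<lambda>n. s n \<bullet> w) \<longlonglongrightarrow> l \<bullet> w" for w
  proof (rule ccontr)
    assume "\<not> (\<lambda>n. s n \<bullet> w) \<longlonglongrightarrow> l \<bullet> w"
    then obtain e where e: "e > 0" "\<forall>N. \<exists>n\<ge>N. e \<le> dist (s n \<bullet> w) (l \<bullet> w)"
      unfolding lim_sequentially by (metis not_le)
    then have "infinite {n. e \<le> dist (s n \<bullet> w) (l \<bullet> w)}"
      by (auto simp: infinite_nat_iff_unbounded_le)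
    then obtain \<tau> where \<tau>: "strict_mono (\<tau> :: nat \<Rightarrow> nat)" "\<And>n. e \<le> dist (s (\<tau> n) \<bullet> w) (l \<bullet> w)"
      using infinite_enumerate by blast
    have "(s \<circ> \<tau>) n \<in> K" "norm ((s \<circ> \<tau>) n) \<le> R + norm z" for n using sK R' by auto
    then obtain l' \<rho> where l': "l' \<in> K" "strict_mono (\<rho> :: nat \<Rightarrow> nat)"
        "weakly_converges_on UNIV ((s \<circ> \<tau>) \<circ> \<rho>) l'"
      by (rule bounded_weakly_convergent_subsequence[OF K])
    have sm: "strict_mono (\<tau> \<circ> \<rho>)" using \<tau> l' by (simp add: strict_mono_o)
    have "l' = l"
      using uniq[OF sm _ _ l(2,3) lZ] cluster[OF sm l'(1)] l'(3) by (simp add: comp_assoc)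
    then have "(\<lambda>n. s (\<tau> (\<rho> n)) \<bullet> w) \<longlonglongrightarrow> l \<bullet> w"
      using l'(3) by (simp add: weakly_converges_on_def)
    then show False using \<tau>(2) e(1) unfolding lim_sequentially by (meson linorder_not_le order_refl)
  qed
  then show thesis using that lZ by (simp add: weakly_converges_on_def)
qed

section \<open>The forward-backward-forward iteration with errors\<close>

text \<open>
  The sequence \<open>s\<close> minus the partial sums of \<open>e\<close> is decreasing and bounded below.
\<close>

lemma quasi_decreasing_convergent:
  fixes s e :: "nat \<Rightarrow> real"
  assumes s: "\<And>n. 0 \<le> s n" "\<And>n. s (Suc n) \<le> s n + e n"
    and e: "\<And>n. 0 \<le> e n" "summable e"
  shows "convergent s"
proof -
  define t where "t = (\<lambda>n. s n - sum e {..<n})"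
  have "decseq t" using s(2) by (intro decseq_SucI) (simp add: t_def diff_le_eq)
  moreover have "- suminf e \<le> t n" for n
    using s(1)[of n] sum_le_suminf[OF e(2), of "{..<n}"] e(1) by (simp add: t_def)
  ultimately obtain L where "t \<longlonglongrightarrow> L" using decseq_convergent by blast
  from tendsto_add[OF this summable_LIMSEQ[OF e(2)]] have "s \<longlonglongrightarrow> L + suminf e"
    by (simp add: t_def)
  then show ?thesis by (rule convergentI)
qed

text \<open>
  Telescoping.
\<close>

lemma summable_decrease:
  fixes s d f :: "nat \<Rightarrow> real"
  assumes "\<And>n. 0 \<le> s n" "\<And>n. 0 \<le> d n" "\<And>n. 0 \<le> f n" "summable f" "\<kappa> > 0"
    and step: "\<And>n. s (Suc n) \<le> s n - \<kappa> * d n + f n"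
  shows "summable d"
proof (rule summableI_nonneg_bounded)
  show "0 \<le> d n" for n by fact
  have *: "s n + \<kappa> * sum d {..<n} \<le> s 0 + sum f {..<n}" for n
    using step by (induction n) (simp_all add: distrib_left, smt (verit))
  show "sum d {..<n} \<le> (s 0 + suminf f) / \<kappa>" for n
  proof -
    have "sum f {..<n} \<le> suminf f" using assms by (intro sum_le_suminf) auto
    then have "\<kappa> * sum d {..<n} \<le> s 0 + suminf f" using *[of n] assms(1)[of n] by linarith
    then show ?thesis using \<open>\<kappa> > 0\<close> by (simp add: field_simps)
  qed
qed

lemma tendsto_inner_null:
  fixes s U :: "nat \<Rightarrow> 'a::real_inner"
  assumes "\<And>n. norm (s n) \<le> R" "U \<longlonglongrightarrow> 0"
  shows "(\<lambda>n. s n \<bullet> U n) \<longlonglongrightarrow> 0"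
proof (rule Lim_null_comparison[where g = "\<lambda>n. R * norm (U n)"])
  have "norm (s n \<bullet> U n) \<le> R * norm (U n)" for n
    using Cauchy_Schwarz_ineq2[of "s n" "U n"] mult_right_mono[OF assms(1)[of n], of "norm (U n)"] by simp
  then show "\<forall>\<^sub>F n in sequentially. norm (s n \<bullet> U n) \<le> R * norm (U n)" by simp
  show "(\<lambda>n. R * norm (U n)) \<longlonglongrightarrow> 0"
    using tendsto_mult_left[OF tendsto_norm[OF assms(2)], of R] by simp
qed

text \<open>
  Monotonicity of \<open>M\<close> and \<open>Q\<close> at \<open>p\<close> and \<open>z\<close> gives \<open>(p - z) \<bullet> (x - p - \<gamma> (Q x - Q p)) \<ge> 0\<close>. In the
  expansion of the squared norm this is the cross term; the only positive contribution left is
  \<open>\<parallel>\<gamma> (Q x - Q p)\<parallel>\<^sup>2\<close>, which the Lipschitz condition controls.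
\<close>

lemma forward_backward_forward_step:
  fixes M :: "'a::real_inner \<Rightarrow> 'a set"
  assumes mono: "monotone_op M"
    and Qmono: "(p - z) \<bullet> (Q p - Q z) \<ge> 0" and Qlip: "norm (Q x - Q p) \<le> \<beta> * norm (x - p)"
    and \<gamma>: "\<gamma> > 0" and \<beta>: "\<beta> \<ge> 0"
    and u: "u \<in> M p" "p + \<gamma> *\<^sub>R u = x - \<gamma> *\<^sub>R Q x" and z: "- Q z \<in> M z"
  shows "(norm (p + \<gamma> *\<^sub>R (Q x - Q p) - z))\<^sup>2
    \<le> (norm (x - z))\<^sup>2 - (1 - (\<gamma> * \<beta>)\<^sup>2) * (norm (x - p))\<^sup>2"
proof -
  have "0 \<le> (p - z) \<bullet> (u - (- Q z))" using monotone_opD[OF mono u(1) z] .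
  with Qmono have "0 \<le> (p - z) \<bullet> (u + Q p)" by (simp add: inner_diff_right inner_add_right)
  then have "0 \<le> (p - z) \<bullet> (\<gamma> *\<^sub>R (u + Q p))" using \<gamma> by simp
  moreover have "\<gamma> *\<^sub>R (u + Q p) = x - p - \<gamma> *\<^sub>R (Q x - Q p)"
    using u(2) by (simp add: algebra_simps)
  ultimately have *: "0 \<le> (p - z) \<bullet> (x - p - \<gamma> *\<^sub>R (Q x - Q p))" by simp
  have "\<gamma> * norm (Q x - Q p) \<le> \<gamma> * (\<beta> * norm (x - p))" using Qlip \<gamma> by simp
  then have "(\<gamma> * norm (Q x - Q p))\<^sup>2 \<le> (\<gamma> * (\<beta> * norm (x - p)))\<^sup>2"
    using \<gamma> by (intro power_mono) auto
  then have **: "(norm (\<gamma> *\<^sub>R (Q x - Q p)))\<^sup>2 \<le> (\<gamma> * \<beta>)\<^sup>2 * (norm (x - p))\<^sup>2"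
    using \<gamma> by (simp add: power_mult_distrib mult.assoc)
  have "(norm (p + d - z))\<^sup>2 = (norm (x - z))\<^sup>2 - (norm (x - p))\<^sup>2 + (norm d)\<^sup>2
      - 2 * ((p - z) \<bullet> (x - p - d))" for d
    by (simp add: power2_norm_eq_inner inner_diff_left inner_diff_right inner_add_left
        inner_add_right inner_commute)
  from this[of "\<gamma> *\<^sub>R (Q x - Q p)"] * ** show ?thesis by (simp add: left_diff_distrib)
qed

text \<open>
  Maximality of \<open>M\<close> appears as the range condition \<open>surj\<close>, which on a product space can be checked
  componentwise. The resolvent is described by its values:
  \<open>pt n\<close> is the exact resolvent of the perturbed forward step and \<open>w n\<close> is the element of \<open>M (pt n)\<close>
  that certifies it. The last conclusion is what strong convergence of components is deduced from.
\<close>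

theorem forward_backward_forward_converges:
  fixes K :: "'a::{real_inner,complete_space} set"
  assumes K: "subspace K" "closed K" and on: "operator_on K M" and mono: "monotone_op M"
    and surj: "\<And>\<gamma> y. \<gamma> > 0 \<Longrightarrow> y \<in> K \<Longrightarrow> \<exists>p u. u \<in> M p \<and> p + \<gamma> *\<^sub>R u = y"
    and QK: "\<And>y. y \<in> K \<Longrightarrow> Q y \<in> K"
    and Qmono: "\<And>x y. x \<in> K \<Longrightarrow> y \<in> K \<Longrightarrow> (x - y) \<bullet> (Q x - Q y) \<ge> 0"
    and lip: "\<beta>-lipschitz_on K Q" and \<beta>: "\<beta> > 0"
    and zero: "\<exists>z. - Q z \<in> M z"
    and \<epsilon>: "0 < \<epsilon>" "\<epsilon> < 1" and \<gamma>: "\<And>n. \<epsilon> \<le> \<gamma> n" "\<And>n. \<gamma> n * \<beta> \<le> 1 - \<epsilon>"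
    and X0: "X 0 \<in> K" and errK: "\<And>n. a n \<in> K" "\<And>n. b n \<in> K" "\<And>n. c n \<in> K"
    and sums: "summable (\<lambda>n. norm (a n))" "summable (\<lambda>n. norm (b n))" "summable (\<lambda>n. norm (c n))"
    and backward: "\<And>n. X n \<in> K \<Longrightarrow>
      w n \<in> M (pt n) \<and> pt n + \<gamma> n *\<^sub>R w n = X n - \<gamma> n *\<^sub>R (Q (X n) + a n) \<and> P n = pt n + b n"
    and X_Suc: "\<And>n. X n \<in> K \<Longrightarrow>
      X (Suc n) = P n + \<gamma> n *\<^sub>R (Q (X n) + a n) - \<gamma> n *\<^sub>R (Q (P n) + c n)"
  obtains zb where "- Q zb \<in> M zb" "summable (\<lambda>n. (norm (X n - P n))\<^sup>2)"
    "weakly_converges_on UNIV X zb" "weakly_converges_on UNIV P zb"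
    "\<forall>n. w n \<in> M (pt n)"
    "(\<lambda>n. X n - pt n) \<longlonglongrightarrow> 0" "(\<lambda>n. P n - pt n) \<longlonglongrightarrow> 0"
    "(\<lambda>n. (pt n - zb) \<bullet> (w n + Q (pt n))) \<longlonglongrightarrow> 0"
proof -
  have \<gamma>0: "\<gamma> n > 0" for n using \<gamma>(1)[of n] \<epsilon> by linarith
  have \<gamma>\<beta>: "\<gamma> n * \<beta> \<le> 1" "\<gamma> n \<le> 1 / \<beta>" for n using \<gamma>(2)[of n] \<epsilon> \<beta> by (auto simp: field_simps)
  have XPK: "X n \<in> K \<and> pt n \<in> K \<and> P n \<in> K" for n
  proof (induction n)
    case 0
    then show ?case using backward[OF X0] X0 operator_onD[OF on] K errK by (metis subspace_add)
  next
    case (Suc n)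
    then have "X (Suc n) \<in> K"
      using X_Suc K errK QK by (simp add: subspace_add subspace_diff subspace_scale)
    then show ?case using backward[of "Suc n"] operator_onD[OF on] K errK by (metis subspace_add)
  qed
  then have XK: "X n \<in> K" and ptK: "pt n \<in> K" and PK: "P n \<in> K" for n by auto
  have wM: "w n \<in> M (pt n)" and pt: "pt n + \<gamma> n *\<^sub>R w n = X n - \<gamma> n *\<^sub>R (Q (X n) + a n)"
    and P: "P n = pt n + b n" for n using backward[OF XK] by auto
  have Ql: "norm (Q x - Q y) \<le> \<beta> * norm (x - y)" if "x \<in> K" "y \<in> K" for x y
    using lipschitz_onD[OF lip that] by (simp add: dist_norm)
  \<comment> \<open>\<open>p n\<close> is the backward step from the forward step without the error \<open>a n\<close>.\<close>
  have "X n - \<gamma> n *\<^sub>R Q (X n) \<in> K" for n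
    using XK QK K by (simp add: subspace_diff subspace_scale)
  then have "\<exists>q v. v \<in> M q \<and> q + \<gamma> n *\<^sub>R v = X n - \<gamma> n *\<^sub>R Q (X n)" for n
    using surj[OF \<gamma>0] by blast
  then obtain p V where "\<And>n. V n \<in> M (p n) \<and> p n + \<gamma> n *\<^sub>R V n = X n - \<gamma> n *\<^sub>R Q (X n)"
    by metis
  then have Vp: "V n \<in> M (p n)" "p n + \<gamma> n *\<^sub>R V n = X n - \<gamma> n *\<^sub>R Q (X n)" for n by auto
  have pK: "p n \<in> K" for n using operator_onD[OF on Vp(1)] by simp
  \<comment> \<open>\<open>E n\<close> bounds both the distance of \<open>P n\<close> to the exact backward step \<open>p n\<close> and that of \<open>X (Suc n)\<close>
    to the exact next iterate \<open>xt n\<close>; it uses \<open>\<gamma> n \<le> 1 / \<beta>\<close> and \<open>\<gamma> n * \<beta> \<le> 1\<close>.\<close>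
  define E where "E = (\<lambda>n. 3 * ((1 / \<beta>) * norm (a n)) + 2 * norm (b n) + (1 / \<beta>) * norm (c n))"
  have E0: "E n \<ge> 0" for n using \<beta> by (simp add: E_def)
  have sumE: "summable E" unfolding E_def by (intro summable_add summable_mult sums)
  define Bd where "Bd = suminf E"
  have EB: "E n \<le> Bd" for n
    using sum_le_suminf[OF sumE, of "{n}"] E0 by (simp add: Bd_def)
  have Pp: "norm (P n - p n) \<le> \<gamma> n * norm (a n) + norm (b n)" for n
  proof -
    have "norm (pt n - p n) \<le> norm ((pt n + \<gamma> n *\<^sub>R w n) - (p n + \<gamma> n *\<^sub>R V n))"
      by (rule resolvent_nonexpansive[OF mono wM Vp(1) \<gamma>0])
    also have "\<dots> = norm (- (\<gamma> n *\<^sub>R a n))" unfolding pt Vp(2) by (simp add: algebra_simps)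
    also have "\<dots> = \<gamma> n * norm (a n)" using \<gamma>0[of n] by simp
    finally show ?thesis using norm_triangle_ineq[of "pt n - p n" "b n"] by (simp add: P algebra_simps)
  qed
  have \<gamma>a: "\<gamma> n * norm v \<le> (1 / \<beta>) * norm v" for n and v :: 'a
    using \<gamma>\<beta>(2) by (rule mult_right_mono) simp
  have PpE: "norm (P n - p n) \<le> E n" for n
  proof -
    have "0 \<le> (1 / \<beta>) * norm (a n)" "0 \<le> (1 / \<beta>) * norm (c n)" using \<beta> by simp_all
    then show ?thesis using Pp[of n] \<gamma>a[of n "a n"] norm_ge_zero[of "b n"] unfolding E_def by linarith
  qed
  have tri: "norm (f - g + h - k) \<le> norm f + norm g + norm h + norm k" for f g h k :: 'a
    by norm
  \<comment> \<open>The next iterate of the error-free step from \<open>X n\<close>.\<close>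
  define xt where "xt = (\<lambda>n. p n + \<gamma> n *\<^sub>R (Q (X n) - Q (p n)))"
  have Xxt: "norm (X (Suc n) - xt n) \<le> E n" for n
  proof -
    have "X (Suc n) - xt n = (P n - p n) - \<gamma> n *\<^sub>R (Q (P n) - Q (p n)) + \<gamma> n *\<^sub>R a n - \<gamma> n *\<^sub>R c n"
      by (simp add: X_Suc[OF XK] xt_def algebra_simps)
    then have "norm (X (Suc n) - xt n)
        \<le> norm (P n - p n) + norm (\<gamma> n *\<^sub>R (Q (P n) - Q (p n))) + norm (\<gamma> n *\<^sub>R a n) + norm (\<gamma> n *\<^sub>R c n)"
      using tri[of "P n - p n" "\<gamma> n *\<^sub>R (Q (P n) - Q (p n))" "\<gamma> n *\<^sub>R a n" "\<gamma> n *\<^sub>R c n"] by simp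
    also have "norm (\<gamma> n *\<^sub>R (Q (P n) - Q (p n))) \<le> norm (P n - p n)"
    proof -
      have "\<gamma> n * norm (Q (P n) - Q (p n)) \<le> \<gamma> n * (\<beta> * norm (P n - p n))"
        using Ql[OF PK pK] \<gamma>0[of n] by (intro mult_left_mono) auto
      also have "\<dots> \<le> 1 * norm (P n - p n)"
        unfolding mult.assoc[symmetric] by (intro mult_right_mono \<gamma>\<beta>) simp
      finally show ?thesis using \<gamma>0[of n] by simp
    qed
    finally have "norm (X (Suc n) - xt n) \<le> 2 * norm (P n - p n) + \<gamma> n * norm (a n) + \<gamma> n * norm (c n)"
      using \<gamma>0[of n] by simp
    also have "\<dots> \<le> E n"
      using Pp[of n] \<gamma>a[of n "a n"] \<gamma>a[of n "c n"] unfolding E_def by linarith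
    finally show ?thesis .
  qed
  \<comment> \<open>A lower bound of \<open>1 - (\<gamma> n * \<beta>)\<^sup>2\<close> that is uniform in \<open>n\<close>.\<close>
  define \<kappa> where "\<kappa> = 1 - (1 - \<epsilon>)\<^sup>2"
  have \<kappa>: "\<kappa> > 0" using \<epsilon> by (simp add: \<kappa>_def power2_eq_square algebra_simps)
  have fejer: "(norm (xt n - z))\<^sup>2 \<le> (norm (X n - z))\<^sup>2 - \<kappa> * (norm (X n - p n))\<^sup>2"
    if z: "- Q z \<in> M z" for n z
  proof -
    have zK: "z \<in> K" using operator_onD[OF on z] by simp
    have "(norm (xt n - z))\<^sup>2 \<le> (norm (X n - z))\<^sup>2 - (1 - (\<gamma> n * \<beta>)\<^sup>2) * (norm (X n - p n))\<^sup>2"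
      unfolding xt_def using \<beta> by (intro forward_backward_forward_step[OF mono Qmono[OF pK zK] Ql[OF XK pK] \<gamma>0 _ Vp z]) simp
    moreover have "(\<gamma> n * \<beta>)\<^sup>2 \<le> (1 - \<epsilon>)\<^sup>2" using \<gamma>(2)[of n] \<gamma>0[of n] \<beta> by (intro power_mono) auto
    then have "\<kappa> * (norm (X n - p n))\<^sup>2 \<le> (1 - (\<gamma> n * \<beta>)\<^sup>2) * (norm (X n - p n))\<^sup>2"
      by (intro mult_right_mono) (auto simp: \<kappa>_def)
    ultimately show ?thesis by linarith
  qed
  have fejer1: "norm (xt n - z) \<le> norm (X n - z)" if "- Q z \<in> M z" for n z
  proof -
    have "0 \<le> \<kappa> * (norm (X n - p n))\<^sup>2" using \<kappa> by simp
    then have "(norm (xt n - z))\<^sup>2 \<le> (norm (X n - z))\<^sup>2" using fejer[OF that, of n] by linarith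
    then show ?thesis by (rule power2_le_imp_le) simp
  qed
  have conv: "convergent (\<lambda>n. norm (X n - z))" if "- Q z \<in> M z" for z
  proof (rule quasi_decreasing_convergent[OF _ _ E0 sumE])
    show "norm (X (Suc n) - z) \<le> norm (X n - z) + E n" for n
      using fejer1[OF that, of n] Xxt[of n] norm_triangle_ineq[of "X (Suc n) - xt n" "xt n - z"] by simp
  qed simp
  obtain z where z: "- Q z \<in> M z" using zero by blast
  from conv[OF z] have "Bseq (\<lambda>n. norm (X n - z))" by (rule convergent_imp_Bseq)
  then obtain R where R0: "R > 0" and R: "norm (X n - z) \<le> R" for n by (auto simp: Bseq_def)
  have sumXp: "summable (\<lambda>n. (norm (X n - p n))\<^sup>2)"
  proof (rule summable_decrease[where s = "\<lambda>n. (norm (X n - z))\<^sup>2" and f = "\<lambda>n. (2 * R + Bd) * E n" and \<kappa> = \<kappa>])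
    have Bd0: "Bd \<ge> 0" using EB[of 0] E0[of 0] by linarith
    show "0 \<le> (2 * R + Bd) * E n" for n using R0 Bd0 E0 by simp
    show "summable (\<lambda>n. (2 * R + Bd) * E n)" by (intro summable_mult sumE)
    show "(norm (X (Suc n) - z))\<^sup>2 \<le> (norm (X n - z))\<^sup>2 - \<kappa> * (norm (X n - p n))\<^sup>2 + (2 * R + Bd) * E n" for n
    proof -
      have "norm (X (Suc n) - z) \<le> norm (xt n - z) + E n"
        using Xxt[of n] norm_triangle_ineq[of "X (Suc n) - xt n" "xt n - z"] by simp
      then have "(norm (X (Suc n) - z))\<^sup>2 \<le> (norm (xt n - z) + E n)\<^sup>2" by (intro power_mono) auto
      also have "\<dots> = (norm (xt n - z))\<^sup>2 + (2 * norm (xt n - z) + E n) * E n"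
        by (simp add: power2_eq_square algebra_simps)
      also have "(2 * norm (xt n - z) + E n) * E n \<le> (2 * R + Bd) * E n"
        using fejer1[OF z, of n] R[of n] EB[of n] E0[of n] by (intro mult_right_mono) auto
      finally show ?thesis using fejer[OF z, of n] by linarith
    qed
  qed (use \<kappa> in auto)
  have sumXP: "summable (\<lambda>n. (norm (X n - P n))\<^sup>2)"
  proof (rule summable_comparison_test')
    show "summable (\<lambda>n. 2 * (norm (X n - p n))\<^sup>2 + 2 * (Bd * E n))"
      by (intro summable_add summable_mult sumXp sumE)
    show "norm ((norm (X n - P n))\<^sup>2) \<le> 2 * (norm (X n - p n))\<^sup>2 + 2 * (Bd * E n)" for n
    proof -
      have "norm (X n - P n) \<le> norm (X n - p n) + norm (P n - p n)"
        using norm_triangle_ineq4[of "X n - p n" "P n - p n"] by simp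
      then have "(norm (X n - P n))\<^sup>2 \<le> (norm (X n - p n) + norm (P n - p n))\<^sup>2"
        by (intro power_mono) auto
      also have "\<dots> \<le> 2 * (norm (X n - p n))\<^sup>2 + 2 * (norm (P n - p n))\<^sup>2"
        using sum_squares_bound[of "norm (X n - p n)" "norm (P n - p n)"] by (simp add: power2_sum)
      also have "(norm (P n - p n))\<^sup>2 \<le> Bd * E n"
        unfolding power2_eq_square using PpE[of n] EB[of n] E0[of n] by (intro mult_mono) auto
      finally show ?thesis by simp
    qed
  qed
  have "(\<lambda>n. sqrt ((norm (X n - P n))\<^sup>2)) \<longlonglongrightarrow> sqrt 0"
    by (intro tendsto_real_sqrt summable_LIMSEQ_zero sumXP)
  then have XP: "(\<lambda>n. X n - P n) \<longlonglongrightarrow> 0" by (simp add: tendsto_norm_zero_iff)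
  have b0: "b \<longlonglongrightarrow> 0" and a0: "a \<longlonglongrightarrow> 0"
    using summable_LIMSEQ_zero[OF sums(2)] summable_LIMSEQ_zero[OF sums(1)]
    by (simp_all add: tendsto_norm_zero_iff)
  have Ppt: "(\<lambda>n. P n - pt n) \<longlonglongrightarrow> 0" using b0 by (simp add: P)
  have Xpt: "(\<lambda>n. X n - pt n) \<longlonglongrightarrow> 0" using tendsto_add[OF XP Ppt] by simp
  \<comment> \<open>The residual: \<open>U n\<close> lies in \<open>(M + Q) (pt n)\<close>.\<close>
  define U where "U = (\<lambda>n. w n + Q (pt n))"
  have U0: "U \<longlonglongrightarrow> 0"
  proof (rule Lim_null_comparison[where g = "\<lambda>n. (1 / \<epsilon>) * norm (X n - pt n) + \<beta> * norm (X n - pt n) + norm (a n)"])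
    have "norm (U n) \<le> (1 / \<epsilon>) * norm (X n - pt n) + \<beta> * norm (X n - pt n) + norm (a n)" for n
    proof -
      have "\<gamma> n *\<^sub>R w n = X n - pt n - \<gamma> n *\<^sub>R (Q (X n) + a n)" using pt[of n] by (simp add: algebra_simps)
      then have "(1 / \<gamma> n) *\<^sub>R (\<gamma> n *\<^sub>R w n) = (1 / \<gamma> n) *\<^sub>R (X n - pt n - \<gamma> n *\<^sub>R (Q (X n) + a n))" by simp
      then have "w n = (1 / \<gamma> n) *\<^sub>R (X n - pt n) - (Q (X n) + a n)"
        using \<gamma>0[of n] by (simp add: scaleR_diff_right)
      then have "U n = (1 / \<gamma> n) *\<^sub>R (X n - pt n) - (Q (X n) - Q (pt n)) - a n" by (simp add: U_def)
      then have "norm (U n) \<le> norm ((1 / \<gamma> n) *\<^sub>R (X n - pt n)) + norm (Q (X n) - Q (pt n)) + norm (a n)"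
        using tri[of "(1 / \<gamma> n) *\<^sub>R (X n - pt n)" "Q (X n) - Q (pt n)" 0 "a n"] by simp
      moreover have "norm ((1 / \<gamma> n) *\<^sub>R (X n - pt n)) \<le> (1 / \<epsilon>) * norm (X n - pt n)"
        using \<gamma>(1)[of n] \<epsilon> \<gamma>0[of n] by (simp add: frac_le)
      ultimately show ?thesis using Ql[OF XK ptK, of n n] by linarith
    qed
    then show "\<forall>\<^sub>F n in sequentially. norm (U n) \<le> (1 / \<epsilon>) * norm (X n - pt n) + \<beta> * norm (X n - pt n) + norm (a n)"
      by simp
    have "(\<lambda>n. (1 / \<epsilon>) * norm (X n - pt n) + \<beta> * norm (X n - pt n) + norm (a n))
      \<longlonglongrightarrow> (1 / \<epsilon>) * norm (0::'a) + \<beta> * norm (0::'a) + norm (0::'a)"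
      by (intro tendsto_intros Xpt a0)
    then show "(\<lambda>n. (1 / \<epsilon>) * norm (X n - pt n) + \<beta> * norm (X n - pt n) + norm (a n)) \<longlonglongrightarrow> 0" by simp
  qed
  have "Bseq (\<lambda>n. X n - pt n)" using Xpt by (intro convergent_imp_Bseq convergentI)
  then obtain R' where R': "norm (X n - pt n) \<le> R'" for n by (auto simp: Bseq_def)
  have ptb: "norm (pt n - y) \<le> R' + R + norm (z - y)" for n y
  proof -
    have "pt n - y = (X n - z) - (X n - pt n) + (z - y)" by simp
    then have "norm (pt n - y) \<le> norm (X n - z) + norm (X n - pt n) + norm (z - y)"
      using tri[of "X n - z" "X n - pt n" "z - y" 0] by simp
    then show ?thesis using R[of n] R'[of n] by linarith
  qed
  have ptU: "(\<lambda>n. (pt n - y) \<bullet> U n) \<longlonglongrightarrow> 0" for y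
    by (rule tendsto_inner_null[OF ptb U0])
  obtain zb where zb: "zb \<in> {z. - Q z \<in> M z}" "weakly_converges_on UNIV X zb"
  proof (rule opial[OF K XK])
    show "{z. - Q z \<in> M z} \<noteq> {}" using z by blast
    show "convergent (\<lambda>n. norm (X n - z))" if "z \<in> {z. - Q z \<in> M z}" for z using conv that by blast
    fix \<sigma> :: "nat \<Rightarrow> nat" and l assume \<sigma>: "strict_mono \<sigma>" and l: "l \<in> K"
      and wl: "weakly_converges_on UNIV (X \<circ> \<sigma>) l"
    have "- Q l \<in> M l"
    proof (rule zero_if_monotonically_related[OF K on mono surj QK lip l])
      fix y v assume yv: "v \<in> M y"
      define g where "g = v + Q y"
      have yK: "y \<in> K" using operator_onD[OF on yv] by simp
      have ge: "0 \<le> (pt n - y) \<bullet> (U n) - (pt n - y) \<bullet> g" for n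
        using monotone_opD[OF mono wM yv, of n] Qmono[OF ptK yK, of n]
        by (simp add: U_def g_def inner_add_right inner_diff_right)
      have "(\<lambda>n. (X (\<sigma> n) - pt (\<sigma> n)) \<bullet> g) \<longlonglongrightarrow> 0 \<bullet> g"
        using LIMSEQ_subseq_LIMSEQ[OF Xpt \<sigma>] by (intro tendsto_inner tendsto_const) (simp add: o_def)
      moreover have "(\<lambda>n. X (\<sigma> n) \<bullet> g) \<longlonglongrightarrow> l \<bullet> g" using wl by (simp add: weakly_converges_on_def)
      ultimately have "(\<lambda>n. X (\<sigma> n) \<bullet> g - (X (\<sigma> n) - pt (\<sigma> n)) \<bullet> g) \<longlonglongrightarrow> l \<bullet> g - 0 \<bullet> g"
        by (intro tendsto_diff)
      then have "(\<lambda>n. pt (\<sigma> n) \<bullet> g) \<longlonglongrightarrow> l \<bullet> g" by (simp add: inner_diff_left)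
      then have "(\<lambda>n. (pt (\<sigma> n) - y) \<bullet> g) \<longlonglongrightarrow> (l - y) \<bullet> g"
        unfolding inner_diff_left by (intro tendsto_diff tendsto_const)
      from tendsto_diff[OF LIMSEQ_subseq_LIMSEQ[OF ptU[of y] \<sigma>] this]
      have "(\<lambda>n. (pt (\<sigma> n) - y) \<bullet> U (\<sigma> n) - (pt (\<sigma> n) - y) \<bullet> g) \<longlonglongrightarrow> 0 - (l - y) \<bullet> g"
        by (simp add: o_def)
      then have "0 \<le> 0 - (l - y) \<bullet> g" using ge by (intro LIMSEQ_le_const) auto
      then show "(l - y) \<bullet> (- (v + Q y)) \<ge> 0" by (simp only: inner_minus_right g_def[symmetric])
    qed
    then show "l \<in> {z. - Q z \<in> M z}" by simp
  qed blast
  have "weakly_converges_on UNIV P zb"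
    unfolding weakly_converges_on_def
  proof
    fix g :: 'a
    have "(\<lambda>n. X n \<bullet> g) \<longlonglongrightarrow> zb \<bullet> g" using zb(2) by (simp add: weakly_converges_on_def)
    moreover have "(\<lambda>n. (X n - P n) \<bullet> g) \<longlonglongrightarrow> 0 \<bullet> g" by (intro tendsto_inner XP tendsto_const)
    ultimately have "(\<lambda>n. X n \<bullet> g - (X n - P n) \<bullet> g) \<longlonglongrightarrow> zb \<bullet> g - 0 \<bullet> g"
      by (rule tendsto_diff)
    then show "(\<lambda>n. P n \<bullet> g) \<longlonglongrightarrow> zb \<bullet> g" by (simp add: inner_diff_left)
  qed
  with zb sumXP wM Xpt Ppt ptU[of zb] show thesis
    by (intro that[of zb]) (simp_all add: U_def)
qed

section \<open>The Hilbert space of square-summable sequences\<close>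

lemma square_summable_add:
  fixes f g :: "nat \<Rightarrow> 'a::real_normed_vector"
  assumes "summable (\<lambda>n. (norm (f n))\<^sup>2)" "summable (\<lambda>n. (norm (g n))\<^sup>2)"
  shows "summable (\<lambda>n. (norm (f n + g n))\<^sup>2)"
proof (rule summable_comparison_test')
  show "summable (\<lambda>n. 2 * (norm (f n))\<^sup>2 + 2 * (norm (g n))\<^sup>2)"
    by (intro summable_add summable_mult assms)
  show "norm ((norm (f n + g n))\<^sup>2) \<le> 2 * (norm (f n))\<^sup>2 + 2 * (norm (g n))\<^sup>2" for n
  proof -
    have "(norm (f n + g n))\<^sup>2 \<le> (norm (f n) + norm (g n))\<^sup>2"
      by (intro power_mono norm_triangle_ineq) simp
    also have "\<dots> \<le> 2 * (norm (f n))\<^sup>2 + 2 * (norm (g n))\<^sup>2"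
      using sum_squares_bound[of "norm (f n)" "norm (g n)"] by (simp add: power2_sum)
    finally show ?thesis by simp
  qed
qed

lemma square_summable_diff:
  fixes f g :: "nat \<Rightarrow> 'a::real_normed_vector"
  assumes "summable (\<lambda>n. (norm (f n))\<^sup>2)" "summable (\<lambda>n. (norm (g n))\<^sup>2)"
  shows "summable (\<lambda>n. (norm (f n - g n))\<^sup>2)"
  using square_summable_add[OF assms(1), of "\<lambda>n. - g n"] assms(2) by simp

lemma summable_inner:
  fixes f g :: "nat \<Rightarrow> 'a::real_inner"
  assumes "summable (\<lambda>n. (norm (f n))\<^sup>2)" "summable (\<lambda>n. (norm (g n))\<^sup>2)"
  shows "summable (\<lambda>n. f n \<bullet> g n)"
proof (rule summable_comparison_test')
  show "summable (\<lambda>n. (norm (f n))\<^sup>2 + (norm (g n))\<^sup>2)"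
    by (intro summable_add assms)
  show "norm (f n \<bullet> g n) \<le> (norm (f n))\<^sup>2 + (norm (g n))\<^sup>2" for n
    using Cauchy_Schwarz_ineq2[of "f n" "g n"] sum_squares_bound[of "norm (f n)" "norm (g n)"]
      mult_nonneg_nonneg[of "norm (f n)" "norm (g n)"] by simp
qed

text \<open>
  Direct sums with a variable number of factors need one type that contains them all.
\<close>

typedef (overloaded) 'a::real_inner ell2 = "{f :: nat \<Rightarrow> 'a. summable (\<lambda>n. (norm (f n))\<^sup>2)}"
  morphisms coord Abs_ell2
  by (rule exI[of _ "\<lambda>_. 0"]) simp

setup_lifting type_definition_ell2

instantiation ell2 :: (real_inner) real_inner
begin

lift_definition zero_ell2 :: "'a ell2" is "\<lambda>_. 0" by simp
lift_definition plus_ell2 :: "'a ell2 \<Rightarrow> 'a ell2 \<Rightarrow> 'a ell2" is "\<lambda>f g n. f n + g n"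
  by (rule square_summable_add)
lift_definition uminus_ell2 :: "'a ell2 \<Rightarrow> 'a ell2" is "\<lambda>f n. - f n" by simp
lift_definition minus_ell2 :: "'a ell2 \<Rightarrow> 'a ell2 \<Rightarrow> 'a ell2" is "\<lambda>f g n. f n - g n"
  by (rule square_summable_diff)
lift_definition scaleR_ell2 :: "real \<Rightarrow> 'a ell2 \<Rightarrow> 'a ell2" is "\<lambda>c f n. c *\<^sub>R f n"
  by (simp only: norm_scaleR power_mult_distrib summable_mult)
lift_definition inner_ell2 :: "'a ell2 \<Rightarrow> 'a ell2 \<Rightarrow> real" is "\<lambda>f g. \<Sum>n. f n \<bullet> g n" .
definition norm_ell2 :: "'a ell2 \<Rightarrow> real" where "norm_ell2 f = sqrt (f \<bullet> f)"
definition sgn_ell2 :: "'a ell2 \<Rightarrow> 'a ell2" where "sgn_ell2 f = inverse (norm f) *\<^sub>R f"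
definition dist_ell2 :: "'a ell2 \<Rightarrow> 'a ell2 \<Rightarrow> real" where "dist_ell2 f g = norm (f - g)"
definition uniformity_ell2 :: "('a ell2 \<times> 'a ell2) filter" where
  "uniformity_ell2 = (INF e\<in>{0 <..}. principal {(f, g). dist f g < e})"
definition open_ell2 :: "'a ell2 set \<Rightarrow> bool" where
  "open_ell2 U = (\<forall>f\<in>U. eventually (\<lambda>(f', g). f' = f \<longrightarrow> g \<in> U) uniformity)"

instance
proof
  fix f g h :: "'a ell2" and r s :: real
  show "f + g + h = f + (g + h)" by transfer (simp add: add.assoc)
  show "f + g = g + f" by transfer (simp add: add.commute)
  show "0 + f = f" by transfer simp
  show "- f + f = 0" by transfer simp
  show "f - g = f + - g" by transfer simp
  show "r *\<^sub>R (f + g) = r *\<^sub>R f + r *\<^sub>R g" by transfer (simp add: scaleR_add_right)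
  show "(r + s) *\<^sub>R f = r *\<^sub>R f + s *\<^sub>R f" by transfer (simp add: scaleR_add_left)
  show "r *\<^sub>R s *\<^sub>R f = (r * s) *\<^sub>R f" by transfer simp
  show "1 *\<^sub>R f = f" by transfer simp
  show "f \<bullet> g = g \<bullet> f" by transfer (simp add: inner_commute)
  show "(f + g) \<bullet> h = f \<bullet> h + g \<bullet> h"
    by transfer (simp add: inner_add_left suminf_add summable_inner)
  show "r *\<^sub>R f \<bullet> g = r * (f \<bullet> g)"
    by transfer (simp add: suminf_mult summable_inner)
  show "0 \<le> f \<bullet> f" by transfer (simp add: suminf_nonneg summable_inner)
  show "f \<bullet> f = 0 \<longleftrightarrow> f = 0"
    by transfer (auto simp: suminf_eq_zero_iff summable_inner fun_eq_iff)
qed (rule norm_ell2_def sgn_ell2_def dist_ell2_def uniformity_ell2_def open_ell2_def)+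

end

lemma sum_norm_coord_le:
  assumes "finite I"
  shows "(\<Sum>n\<in>I. (norm (coord f n))\<^sup>2) \<le> (norm f)\<^sup>2"
  using coord[of f] assms unfolding power2_norm_eq_inner inner_ell2.rep_eq
  by (intro sum_le_suminf) (auto simp: power2_norm_eq_inner)

lemma norm_coord_le: "norm (coord f k) \<le> norm f"
  by (rule power2_le_imp_le) (use sum_norm_coord_le[of "{k}" f] in simp_all)

lemma ell2_of_bounded_partial_sums:
  assumes "\<And>N. (\<Sum>n<N. (norm (f n))\<^sup>2) \<le> e\<^sup>2" "e \<ge> 0"
  obtains F where "coord F = f" "norm F \<le> e"
proof -
  have sm: "summable (\<lambda>n. (norm (f n))\<^sup>2)" using assms by (intro summableI_nonneg_bounded) auto
  define F where "F = Abs_ell2 f"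
  have F: "coord F = f" using sm by (simp add: F_def Abs_ell2_inverse)
  have "(norm F)\<^sup>2 \<le> e\<^sup>2"
    using sm suminf_le_const[OF sm assms(1)] by (simp add: power2_norm_eq_inner inner_ell2.rep_eq F)
  then have "norm F \<le> e" using assms(2) by (rule power2_le_imp_le)
  with F show thesis by (rule that)
qed

text \<open>
  Coordinates of a Cauchy sequence converge. The bounds on \<open>\<parallel>X n - X m\<parallel>\<close> pass to the limit \<open>m \<rightarrow> \<infinity>\<close> in each
  finite partial sum, which shows at once that the coordinatewise limit is square-summable and that the
  convergence is in norm.
\<close>

instance ell2 :: ("{real_inner, complete_space}") complete_space
proof
  fix X :: "nat \<Rightarrow> 'a ell2" assume "Cauchy X"
  have "Cauchy (\<lambda>n. coord (X n) k)" for k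
  proof (rule metric_CauchyI)
    fix e :: real assume "e > 0"
    then obtain N where N: "\<forall>m\<ge>N. \<forall>n\<ge>N. dist (X m) (X n) < e" using metric_CauchyD[OF \<open>Cauchy X\<close>] by blast
    have "dist (coord (X m) k) (coord (X n) k) \<le> dist (X m) (X n)" for m n
      using norm_coord_le[of "X m - X n" k] by (simp add: dist_norm minus_ell2.rep_eq)
    with N show "\<exists>N. \<forall>m\<ge>N. \<forall>n\<ge>N. dist (coord (X m) k) (coord (X n) k) < e"
      by (meson le_less_trans)
  qed
  then have "\<exists>l. (\<lambda>n. coord (X n) k) \<longlonglongrightarrow> l" for k
    using Cauchy_convergent convergent_def by blast
  then obtain l where l: "\<And>k. (\<lambda>n. coord (X n) k) \<longlonglongrightarrow> l k" by metis
  have close: "\<exists>N. \<forall>n\<ge>N. \<exists>F. coord F = (\<lambda>k. coord (X n) k - l k) \<and> norm F \<le> e" if e: "e > 0" for e :: real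
  proof -
    obtain N where N: "\<And>m n. m \<ge> N \<Longrightarrow> n \<ge> N \<Longrightarrow> norm (X m - X n) < e"
      using metric_CauchyD[OF \<open>Cauchy X\<close> e] by (auto simp: dist_norm)
    have "\<exists>F. coord F = (\<lambda>k. coord (X n) k - l k) \<and> norm F \<le> e" if n: "n \<ge> N" for n
    proof -
      have "(\<Sum>k<J. (norm (coord (X n) k - l k))\<^sup>2) \<le> e\<^sup>2" for J
      proof (rule LIMSEQ_le_const2)
        show "(\<lambda>m. \<Sum>k<J. (norm (coord (X n) k - coord (X m) k))\<^sup>2)
            \<longlonglongrightarrow> (\<Sum>k<J. (norm (coord (X n) k - l k))\<^sup>2)"
          by (intro tendsto_intros l)
        have "(\<Sum>k<J. (norm (coord (X n) k - coord (X m) k))\<^sup>2) \<le> e\<^sup>2" if m: "m \<ge> N" for m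
        proof -
          have "(\<Sum>k<J. (norm (coord (X n) k - coord (X m) k))\<^sup>2) \<le> (norm (X n - X m))\<^sup>2"
            using sum_norm_coord_le[of "{..<J}" "X n - X m"] by (simp add: minus_ell2.rep_eq)
          also have "\<dots> \<le> e\<^sup>2" using N[OF n m] by (intro power_mono) auto
          finally show ?thesis .
        qed
        then show "\<exists>M. \<forall>m\<ge>M. (\<Sum>k<J. (norm (coord (X n) k - coord (X m) k))\<^sup>2) \<le> e\<^sup>2" by blast
      qed
      from ell2_of_bounded_partial_sums[OF this] e show ?thesis by (metis less_imp_le)
    qed
    then show ?thesis by blast
  qed
  obtain n0 F0 where F0: "coord F0 = (\<lambda>k. coord (X n0) k - l k)" using close[of 1] by fastforce
  define Y where "Y = X n0 - F0"
  have Y: "coord Y = l" by (simp add: Y_def minus_ell2.rep_eq F0)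
  have "X \<longlonglongrightarrow> Y"
    unfolding lim_sequentially
  proof (intro allI impI)
    fix e :: real assume "e > 0"
    then obtain N where N: "\<forall>n\<ge>N. \<exists>F. coord F = (\<lambda>k. coord (X n) k - l k) \<and> norm F \<le> e / 2"
      using close[of "e / 2"] by auto
    have "dist (X n) Y < e" if n: "n \<ge> N" for n
    proof -
      obtain F where F: "coord F = (\<lambda>k. coord (X n) k - l k)" "norm F \<le> e / 2" using N n by blast
      have "coord F = coord (X n - Y)" by (simp add: F minus_ell2.rep_eq Y)
      then have "F = X n - Y" by (simp add: coord_inject)
      with F \<open>e > 0\<close> show ?thesis by (simp add: dist_norm)
    qed
    then show "\<exists>N. \<forall>n\<ge>N. dist (X n) Y < e" by blast
  qed
  then show "convergent X" by (rule convergentI)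
qed

lemma ell2_eqI: "(\<And>i. coord f i = coord g i) \<Longrightarrow> f = g"
  by (metis coord_inject ext)

lemma bounded_linear_coord: "bounded_linear (\<lambda>f. coord f k)"
  by (rule bounded_linear_intro[where K = 1])
     (simp_all add: plus_ell2.rep_eq scaleR_ell2.rep_eq norm_coord_le)

definition family :: "nat \<Rightarrow> (nat \<Rightarrow> 'a::real_inner) \<Rightarrow> 'a ell2" where
  "family m f = Abs_ell2 (\<lambda>i. if i \<in> {1..m} then f i else 0)"

lemma coord_family: "coord (family m f) i = (if i \<in> {1..m} then f i else 0)"
proof -
  have "summable (\<lambda>i. (norm (if i \<in> {1..m} then f i else 0))\<^sup>2)"
    by (rule summable_finite[of "{1..m}"]) auto
  then show ?thesis by (simp add: family_def Abs_ell2_inverse)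
qed

lemma inner_eq_sum:
  assumes "\<And>i. i \<notin> {1..m} \<Longrightarrow> coord f i = 0"
  shows "f \<bullet> g = (\<Sum>i=1..m. coord f i \<bullet> coord g i)"
  unfolding inner_ell2.rep_eq by (rule suminf_finite) (use assms in auto)

lemma norm_eq_L2_set:
  assumes "\<And>i. i \<notin> {1..m} \<Longrightarrow> coord f i = 0"
  shows "norm f = L2_set (\<lambda>i. norm (coord f i)) {1..m}"
  unfolding norm_eq_sqrt_inner[of f] L2_set_def using inner_eq_sum[of m f f] assms
  by (simp add: power2_norm_eq_inner)

lemma norm_family_le: "norm (family m f) \<le> (\<Sum>i=1..m. norm (f i))"
proof -
  have "norm (family m f) = L2_set (\<lambda>i. norm (coord (family m f) i)) {1..m}"
    by (rule norm_eq_L2_set) (auto simp: coord_family)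
  also have "\<dots> \<le> (\<Sum>i=1..m. norm (coord (family m f) i))" by (rule L2_set_le_sum) simp
  also have "\<dots> = (\<Sum>i=1..m. norm (f i))" by (intro sum.cong) (auto simp: coord_family)
  finally show ?thesis .
qed

text \<open>
  The sequences that vanish outside the index range form an isometric copy of the Hilbert direct sum of
  the \<open>G i\<close>.
\<close>

definition direct_sum :: "nat \<Rightarrow> (nat \<Rightarrow> 'a::real_inner set) \<Rightarrow> 'a ell2 set" where
  "direct_sum m G = {f. (\<forall>i\<in>{1..m}. coord f i \<in> G i) \<and> (\<forall>i. i \<notin> {1..m} \<longrightarrow> coord f i = 0)}"

lemma family_in_direct_sum: "(\<And>i. i \<in> {1..m} \<Longrightarrow> f i \<in> G i) \<Longrightarrow> family m f \<in> direct_sum m G"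
  by (simp add: direct_sum_def coord_family)

lemma subspace_direct_sum:
  assumes "\<And>i. i \<in> {1..m} \<Longrightarrow> subspace (G i)"
  shows "subspace (direct_sum m G)"
  using assms
  by (auto simp: subspace_def direct_sum_def zero_ell2.rep_eq plus_ell2.rep_eq scaleR_ell2.rep_eq)

lemma closed_direct_sum:
  assumes "\<And>i. i \<in> {1..m} \<Longrightarrow> closed (G i)"
  shows "closed (direct_sum m G)"
proof -
  have c: "continuous_on UNIV (\<lambda>f :: 'a ell2. coord f i)" for i
    by (rule linear_continuous_on[OF bounded_linear_coord])
  have "direct_sum m G = (\<Inter>i\<in>{1..m}. (\<lambda>f. coord f i) -` G i) \<inter> (\<Inter>i\<in>-{1..m}. (\<lambda>f. coord f i) -` {0})"
    by (auto simp: direct_sum_def)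
  also have "closed \<dots>"
    by (intro closed_Int closed_INT ballI closed_vimage c assms closed_singleton)
  finally show ?thesis .
qed

lemma coord_diff: "coord (f - g) i = coord f i - coord g i" by (simp add: minus_ell2.rep_eq)

section \<open>Uniform monotonicity\<close>

text \<open>
  If \<open>\<parallel>s n - l\<parallel> \<ge> e\<close>, then the inner product is at least \<open>\<phi> e > 0\<close>, which fails for large \<open>n\<close>.
\<close>

lemma uniformly_monotone_at_tendsto:
  fixes s w :: "nat \<Rightarrow> 'a::real_inner"
  assumes um: "uniformly_monotone_at N l" and u: "u \<in> N l" and w: "\<And>n. w n \<in> N (s n)"
    and lim: "(\<lambda>n. (s n - l) \<bullet> (w n - u)) \<longlonglongrightarrow> 0"
  shows "s \<longlonglongrightarrow> l"
proof -
  obtain \<phi> :: "real \<Rightarrow> ereal" where \<phi>: "\<And>t. t \<ge> 0 \<Longrightarrow> 0 \<le> \<phi> t" "mono_on {0..} \<phi>"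
    "\<And>t. t \<ge> 0 \<Longrightarrow> \<phi> t = 0 \<longleftrightarrow> t = 0"
    and ge: "\<And>u y v. u \<in> N l \<Longrightarrow> v \<in> N y \<Longrightarrow> \<phi> (norm (l - y)) \<le> ereal ((l - y) \<bullet> (u - v))"
    using um unfolding uniformly_monotone_at_def by (force simp: gra_def)
  show ?thesis
  proof (rule metric_LIMSEQ_I)
    fix e :: real assume e: "e > 0"
    then have "0 < \<phi> e" using \<phi>(1,3)[of e] by (simp add: order_less_le)
    then obtain d where d: "0 < ereal d" "ereal d < \<phi> e" using ereal_dense2 by blast
    obtain N0 where N0: "\<And>n. n \<ge> N0 \<Longrightarrow> \<bar>(s n - l) \<bullet> (w n - u)\<bar> < d"
      using metric_LIMSEQ_D[OF lim, of d] d by (auto simp: dist_real_def)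
    have "dist (s n) l < e" if n: "n \<ge> N0" for n
    proof (rule ccontr)
      assume "\<not> dist (s n) l < e"
      then have "\<phi> e \<le> \<phi> (norm (l - s n))"
        using e by (intro mono_onD[OF \<phi>(2)]) (auto simp: dist_norm norm_minus_commute)
      also have "\<dots> \<le> ereal ((l - s n) \<bullet> (u - w n))" by (rule ge[OF u w])
      also have "(l - s n) \<bullet> (u - w n) = (s n - l) \<bullet> (w n - u)"
        by (simp add: inner_diff_left inner_diff_right)
      also have "ereal \<dots> < ereal d" using N0[OF n] by simp
      finally show False using d(2) by simp
    qed
    then show "\<exists>N. \<forall>n\<ge>N. dist (s n) l < e" by blast
  qed
qed

section \<open>The monotone operators of the primal-dual problem\<close>

locale primal_dual =
  fixes z :: "'h::{real_inner, complete_space}"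
    and m :: nat
    and A :: "'h \<Rightarrow> 'h set"
    and C :: "'h \<Rightarrow> 'h"
    and \<mu> :: real
    and G :: "nat \<Rightarrow> 'g::{real_inner, complete_space} set"
    and r :: "nat \<Rightarrow> 'g"
    and B D :: "nat \<Rightarrow> 'g \<Rightarrow> 'g set"
    and \<nu> :: "nat \<Rightarrow> real"
    and L :: "nat \<Rightarrow> 'h \<Rightarrow> 'g"
  assumes A: "maximally_monotone_on UNIV A"
    and C_mono: "monotone_op (single_valued_op C)"
    and C_lipschitz: "\<mu>-lipschitz_on UNIV C"
    and G: "\<And>i. i \<in> {1..m} \<Longrightarrow> subspace (G i)" "\<And>i. i \<in> {1..m} \<Longrightarrow> closed (G i)"
    and r: "\<And>i. i \<in> {1..m} \<Longrightarrow> r i \<in> G i"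
    and B: "\<And>i. i \<in> {1..m} \<Longrightarrow> maximally_monotone_on (G i) (B i)"
    and D_mono: "\<And>i. i \<in> {1..m} \<Longrightarrow> monotone_op (D i)"
    and D_inv_lipschitz: "\<And>i. i \<in> {1..m} \<Longrightarrow> lipschitzian_op_on (\<nu> i) (G i) (op_inverse (D i))"
    and L: "\<And>i. i \<in> {1..m} \<Longrightarrow> bounded_linear (L i)" "\<And>i x. i \<in> {1..m} \<Longrightarrow> L i x \<in> G i"
begin

definition Dinv :: "nat \<Rightarrow> 'g \<Rightarrow> 'g" where
  "Dinv i v = the_elem (op_inverse (D i) v)"

definition K :: "('h \<times> 'g ell2) set" where
  "K = UNIV \<times> direct_sum m G"

text \<open>
  The product of \<open>A - z\<close> and of the operators \<open>v \<mapsto> op_inverse (B i) v + r i\<close>; absorbing \<open>z\<close> and \<open>r i\<close> here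
  turns the shifted resolvents of the algorithm into resolvents of one operator.
\<close>

definition M :: "'h \<times> 'g ell2 \<Rightarrow> ('h \<times> 'g ell2) set" where
  "M p = {w. fst w + z \<in> A (fst p) \<and> snd p \<in> direct_sum m G \<and> snd w \<in> direct_sum m G \<and>
     (\<forall>i\<in>{1..m}. coord (snd w) i - r i \<in> op_inverse (B i) (coord (snd p) i))}"

definition Q :: "'h \<times> 'g ell2 \<Rightarrow> 'h \<times> 'g ell2" where
  "Q p = (C (fst p) + (\<Sum>i=1..m. adjoint (L i) (coord (snd p) i)),
          family m (\<lambda>i. Dinv i (coord (snd p) i) - L i (fst p)))"

lemma subspace_K: "subspace K"
  unfolding K_def by (intro subspace_Times subspace_UNIV subspace_direct_sum G)

lemma closed_K: "closed K"
  unfolding K_def by (intro closed_Times closed_UNIV closed_direct_sum G)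

lemma Dinv:
  assumes i: "i \<in> {1..m}"
  shows op_inverse_D: "v \<in> G i \<Longrightarrow> op_inverse (D i) v = {Dinv i v}"
    and Dinv_in: "v \<in> G i \<Longrightarrow> Dinv i v \<in> G i"
    and Dinv_mono: "v \<in> G i \<Longrightarrow> w \<in> G i \<Longrightarrow> (v - w) \<bullet> (Dinv i v - Dinv i w) \<ge> 0"
    and Dinv_lipschitz: "v \<in> G i \<Longrightarrow> w \<in> G i \<Longrightarrow> norm (Dinv i v - Dinv i w) \<le> \<nu> i * norm (v - w)"
proof -
  obtain T where T: "\<And>v. v \<in> G i \<Longrightarrow> op_inverse (D i) v = {T v}" "(\<nu> i)-lipschitz_on (G i) T"
    and on: "operator_on (G i) (op_inverse (D i))"
    using D_inv_lipschitz[OF i] by (auto simp: lipschitzian_op_on_def)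
  have DT: "Dinv i v = T v" if "v \<in> G i" for v using T(1)[OF that] by (simp add: Dinv_def)
  show 1: "op_inverse (D i) v = {Dinv i v}" if "v \<in> G i" for v using T(1) DT that by simp
  show "Dinv i v \<in> G i" if "v \<in> G i" for v using operator_onD[OF on, of "Dinv i v" v] 1[OF that] by simp
  show "(v - w) \<bullet> (Dinv i v - Dinv i w) \<ge> 0" if "v \<in> G i" "w \<in> G i" for v w
  proof -
    have "v \<in> D i (Dinv i v)" "w \<in> D i (Dinv i w)"
      using 1 that by (auto simp: op_inverse_def)
    from monotone_opD[OF D_mono[OF i] this] show ?thesis by (simp add: inner_commute)
  qed
  show "norm (Dinv i v - Dinv i w) \<le> \<nu> i * norm (v - w)" if "v \<in> G i" "w \<in> G i" for v w
    using lipschitz_onD[OF T(2) that] DT that by (simp add: dist_norm)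
qed

lemma inner_adjoint_sum: "x \<bullet> (\<Sum>i=1..m. adjoint (L i) (y i)) = (\<Sum>i=1..m. L i x \<bullet> y i)"
  unfolding inner_sum_right by (intro sum.cong refl adjoint_bounded_linear L)

lemma operator_on_M: "operator_on K M"
  by (auto simp: operator_on_def gra_def M_def K_def)

lemma Binv: "i \<in> {1..m} \<Longrightarrow> maximally_monotone_on (G i) (op_inverse (B i))"
  by (intro maximally_monotone_on_op_inverse B)

lemma Binv_mono: "i \<in> {1..m} \<Longrightarrow> monotone_op (op_inverse (B i))"
  using Binv by (simp add: maximally_monotone_on_def)

lemma Binv_on: "i \<in> {1..m} \<Longrightarrow> operator_on (G i) (op_inverse (B i))"
  using Binv by (simp add: maximally_monotone_on_def)

lemma L_diff: "i \<in> {1..m} \<Longrightarrow> L i (x - y) = L i x - L i y"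
  by (intro linear_diff bounded_linear.linear L)

lemma A_mono: "monotone_op A"
  using A by (simp add: maximally_monotone_on_def)

lemma inner_M:
  assumes "w \<in> M p" "w' \<in> M p'"
  shows "(p - p') \<bullet> (w - w') = (fst p - fst p') \<bullet> ((fst w + z) - (fst w' + z)) +
    (\<Sum>i=1..m. (coord (snd p) i - coord (snd p') i) \<bullet>
       ((coord (snd w) i - r i) - (coord (snd w') i - r i)))"
proof -
  have "(snd p - snd p') \<bullet> (snd w - snd w') = (\<Sum>i=1..m. coord (snd p - snd p') i \<bullet> coord (snd w - snd w') i)"
    using assms by (intro inner_eq_sum) (auto simp: M_def direct_sum_def coord_diff)
  then show ?thesis by (simp add: inner_prod_def coord_diff)
qed

lemma monotone_M_parts:
  assumes "w \<in> M p" "w' \<in> M p'"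
  shows "(fst p - fst p') \<bullet> ((fst w + z) - (fst w' + z)) \<ge> 0"
    and "i \<in> {1..m} \<Longrightarrow> (coord (snd p) i - coord (snd p') i) \<bullet>
       ((coord (snd w) i - r i) - (coord (snd w') i - r i)) \<ge> 0"
  using monotone_opD[OF A_mono, of "fst w + z" "fst p" "fst w' + z" "fst p'"]
    monotone_opD[OF Binv_mono, of i "coord (snd w) i - r i" "coord (snd p) i"
      "coord (snd w') i - r i" "coord (snd p') i"] assms
  by (auto simp: M_def)

lemma monotone_M: "monotone_op M"
proof (rule monotone_opI)
  fix p p' w w' assume w: "w \<in> M p" "w' \<in> M p'"
  show "(p - p') \<bullet> (w - w') \<ge> 0"
    unfolding inner_M[OF w] by (intro add_nonneg_nonneg sum_nonneg monotone_M_parts[OF w])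
qed

text \<open>
  The operator \<open>M\<close> is a product, so the equation splits into one for \<open>A\<close> and one for each inverse of
  \<open>B i\<close>, which Minty's theorem solves.
\<close>

lemma surjective_M:
  assumes \<gamma>: "\<gamma> > 0" and y: "y \<in> K"
  shows "\<exists>p w. w \<in> M p \<and> p + \<gamma> *\<^sub>R w = y"
proof -
  obtain p0 u0 where A0: "u0 \<in> A p0" "p0 + \<gamma> *\<^sub>R u0 = fst y + \<gamma> *\<^sub>R z"
    using minty_surjective[OF subspace_UNIV closed_UNIV A \<gamma>] by blast
  have "\<exists>p u. u \<in> op_inverse (B i) p \<and> p + \<gamma> *\<^sub>R u = coord (snd y) i - \<gamma> *\<^sub>R r i" if i: "i \<in> {1..m}" for i
  proof (rule minty_surjective[OF G(1)[OF i] G(2)[OF i] Binv[OF i] \<gamma>])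
    show "coord (snd y) i - \<gamma> *\<^sub>R r i \<in> G i"
      using y i r[OF i] G(1)[OF i] by (auto simp: K_def direct_sum_def intro!: subspace_diff subspace_scale)
  qed
  then obtain p u where pu: "\<And>i. i \<in> {1..m} \<Longrightarrow> u i \<in> op_inverse (B i) (p i) \<and> p i + \<gamma> *\<^sub>R u i = coord (snd y) i - \<gamma> *\<^sub>R r i"
    by metis
  have on: "p i \<in> G i \<and> u i \<in> G i" if "i \<in> {1..m}" for i
    using operator_onD[OF Binv_on[OF that]] pu[OF that] by blast
  have "(u0 - z, family m (\<lambda>i. u i + r i)) \<in> M (p0, family m p)"
    using A0 pu on r G(1)
    by (auto simp: M_def coord_family intro!: family_in_direct_sum subspace_add)
  moreover have "(p0, family m p) + \<gamma> *\<^sub>R (u0 - z, family m (\<lambda>i. u i + r i)) = y"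
  proof (rule prod_eqI)
    show "fst ((p0, family m p) + \<gamma> *\<^sub>R (u0 - z, family m (\<lambda>i. u i + r i))) = fst y"
      using A0 by (simp add: algebra_simps)
    have "coord (family m p + \<gamma> *\<^sub>R family m (\<lambda>i. u i + r i)) i = coord (snd y) i" for i
      using pu[of i] y
      by (auto simp: plus_ell2.rep_eq scaleR_ell2.rep_eq coord_family K_def direct_sum_def algebra_simps)
    then show "snd ((p0, family m p) + \<gamma> *\<^sub>R (u0 - z, family m (\<lambda>i. u i + r i))) = snd y"
      by (simp add: ell2_eqI)
  qed
  ultimately show ?thesis by blast
qed

lemma Q_in_K:
  assumes "p \<in> K" shows "Q p \<in> K"
  using assms G(1) L(2) Dinv_in
  by (auto simp: K_def Q_def direct_sum_def coord_family intro!: subspace_diff)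

text \<open>
  The contributions of the \<open>L i\<close> and of their adjoints cancel: that part of \<open>Q\<close> is skew.
\<close>

lemma inner_Q:
  assumes "p \<in> K" "p' \<in> K"
  shows "(p - p') \<bullet> (Q p - Q p') = (fst p - fst p') \<bullet> (C (fst p) - C (fst p')) +
    (\<Sum>i=1..m. (coord (snd p) i - coord (snd p') i) \<bullet>
       (Dinv i (coord (snd p) i) - Dinv i (coord (snd p') i)))"
proof -
  have 1: "(snd p - snd p') \<bullet> (snd (Q p) - snd (Q p'))
      = (\<Sum>i=1..m. coord (snd p - snd p') i \<bullet> coord (snd (Q p) - snd (Q p')) i)"
    using assms by (intro inner_eq_sum) (auto simp: K_def direct_sum_def coord_diff)
  have 2: "(\<Sum>i=1..m. coord (snd p - snd p') i \<bullet> coord (snd (Q p) - snd (Q p')) i) =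
    (\<Sum>i=1..m. (coord (snd p) i - coord (snd p') i) \<bullet>
       (Dinv i (coord (snd p) i) - Dinv i (coord (snd p') i))
      - L i (fst p - fst p') \<bullet> (coord (snd p) i - coord (snd p') i))"
    by (intro sum.cong refl)
       (auto simp: coord_diff Q_def coord_family L_diff inner_diff_right
         inner_diff_left inner_commute)
  have 3: "(fst p - fst p') \<bullet> (fst (Q p) - fst (Q p')) = (fst p - fst p') \<bullet> (C (fst p) - C (fst p'))
     + (\<Sum>i=1..m. L i (fst p - fst p') \<bullet> (coord (snd p) i - coord (snd p') i))"
    unfolding Q_def inner_diff_right[of _ "coord _ _"] sum_subtractf inner_adjoint_sum[symmetric]
    by (simp add: inner_add_right inner_diff_right)
  show ?thesis
    using 1 2 3 by (simp add: inner_prod_def sum_subtractf)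
qed

lemma monotone_Q_parts:
  assumes "p \<in> K" "p' \<in> K"
  shows "(fst p - fst p') \<bullet> (C (fst p) - C (fst p')) \<ge> 0"
    and "i \<in> {1..m} \<Longrightarrow> (coord (snd p) i - coord (snd p') i) \<bullet>
       (Dinv i (coord (snd p) i) - Dinv i (coord (snd p') i)) \<ge> 0"
  using monotone_opD[OF C_mono] assms Dinv_mono
  by (auto simp: single_valued_op_def K_def direct_sum_def)

lemma monotone_Q:
  assumes "p \<in> K" "p' \<in> K"
  shows "(p - p') \<bullet> (Q p - Q p') \<ge> 0"
  unfolding inner_Q[OF assms] by (intro add_nonneg_nonneg sum_nonneg monotone_Q_parts[OF assms])

text \<open>
  Write \<open>Q p - Q p' = U + S\<close>, where \<open>U\<close> collects the contributions of \<open>C\<close> and of the inverses of the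
  \<open>D i\<close>, and \<open>S\<close> those of the \<open>L i\<close>. The first part acts componentwise, with constant \<open>\<kappa>\<close>. The second
  one is skew and exchanges primal and dual components, so its norm is the norm \<open>l\<close> of
  \<open>x \<mapsto> (L 1 x, \<dots>, L m x)\<close>, for which Cauchy-Schwarz gives the bound below.
\<close>

lemma lipschitz_Q:
  assumes \<kappa>: "\<mu> \<le> \<kappa>" "\<And>i. i \<in> {1..m} \<Longrightarrow> \<nu> i \<le> \<kappa>"
  shows "(\<kappa> + sqrt (\<Sum>i=1..m. (onorm (L i))\<^sup>2))-lipschitz_on K Q"
proof (rule lipschitz_onI)
  define l where "l = sqrt (\<Sum>i=1..m. (onorm (L i))\<^sup>2)"
  have \<mu>0: "0 \<le> \<mu>" using C_lipschitz by (rule lipschitz_on_nonneg)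
  then have \<kappa>0: "0 \<le> \<kappa>" using \<kappa>(1) by linarith
  have l0: "0 \<le> l" by (simp add: l_def sum_nonneg)
  show "0 \<le> \<kappa> + sqrt (\<Sum>i=1..m. (onorm (L i))\<^sup>2)" using \<kappa>0 l0 by (simp add: l_def)
  fix p p' assume p: "p \<in> K" "p' \<in> K"
  define d where "d = fst p - fst p'"
  define e where "e = (\<lambda>i. coord (snd p) i - coord (snd p') i)"
  have ne: "norm (snd (p - p')) = L2_set (\<lambda>i. norm (e i)) {1..m}"
    using norm_eq_L2_set[of m "snd (p - p')"] p
    by (auto simp: K_def direct_sum_def coord_diff e_def)
  define U where "U = (C (fst p) - C (fst p'), family m (\<lambda>i. Dinv i (coord (snd p) i) - Dinv i (coord (snd p') i)))"
  define h where "h = (\<Sum>i=1..m. adjoint (L i) (coord (snd p) i)) - (\<Sum>i=1..m. adjoint (L i) (coord (snd p') i))"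
  define S where "S = (h, family m (\<lambda>i. - L i d))"
  have split: "Q p - Q p' = U + S"
    by (rule prod_eqI)
       (auto simp: Q_def U_def S_def h_def d_def coord_diff coord_family plus_ell2.rep_eq
          L_diff intro!: ell2_eqI)
  have nU: "norm U \<le> \<kappa> * norm (p - p')"
  proof -
    have "norm (fst U) \<le> \<kappa> * norm d"
    proof -
      have "norm (fst U) \<le> \<mu> * norm d"
        using lipschitz_onD[OF C_lipschitz, of "fst p" "fst p'"] by (simp add: U_def d_def dist_norm)
      also have "\<dots> \<le> \<kappa> * norm d" using \<kappa>(1) by (intro mult_right_mono) auto
      finally show ?thesis .
    qed
    moreover have "norm (snd U) \<le> \<kappa> * norm (snd (p - p'))"
    proof -
      have "norm (snd U) = L2_set (\<lambda>i. norm (coord (snd U) i)) {1..m}"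
        by (rule norm_eq_L2_set) (auto simp: U_def coord_family)
      also have "\<dots> \<le> L2_set (\<lambda>i. \<kappa> * norm (e i)) {1..m}"
      proof (rule L2_set_mono)
        fix i assume i: "i \<in> {1..m}"
        have "norm (coord (snd U) i) \<le> \<nu> i * norm (e i)"
          using Dinv_lipschitz[OF i] p i by (auto simp: U_def coord_family e_def K_def direct_sum_def)
        also have "\<dots> \<le> \<kappa> * norm (e i)" using \<kappa>(2)[OF i] by (intro mult_right_mono) auto
        finally show "norm (coord (snd U) i) \<le> \<kappa> * norm (e i)" .
      qed simp
      also have "\<dots> = \<kappa> * norm (snd (p - p'))" unfolding ne using \<kappa>0 by (simp add: L2_set_right_distrib)
      finally show ?thesis .
    qed
    ultimately have "sqrt ((norm (fst U))\<^sup>2 + (norm (snd U))\<^sup>2) \<le> sqrt ((\<kappa> * norm d)\<^sup>2 + (\<kappa> * norm (snd (p - p')))\<^sup>2)"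
      by (intro real_sqrt_le_mono add_mono power_mono) auto
    also have "\<dots> = \<kappa> * norm (p - p')"
      using \<kappa>0 by (simp add: norm_prod_def d_def power_mult_distrib real_sqrt_mult flip: distrib_left)
    finally show ?thesis by (simp add: norm_prod_def)
  qed
  have nh: "norm h \<le> l * norm (snd (p - p'))"
  proof (cases "h = 0")
    case False
    have "norm h * norm h = h \<bullet> h" by (simp add: power2_norm_eq_inner flip: power2_eq_square)
    also have "\<dots> = (\<Sum>i=1..m. L i h \<bullet> e i)"
      using inner_adjoint_sum[of h "\<lambda>i. coord (snd p) i"] inner_adjoint_sum[of h "\<lambda>i. coord (snd p') i"]
      by (subst (2) h_def) (simp add: inner_diff_right e_def sum_subtractf)
    also have "\<dots> \<le> (\<Sum>i=1..m. norm h * (\<bar>onorm (L i)\<bar> * \<bar>norm (e i)\<bar>))"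
    proof (rule sum_mono)
      fix i assume i: "i \<in> {1..m}"
      have "L i h \<bullet> e i \<le> norm (L i h) * norm (e i)" by (rule norm_cauchy_schwarz)
      also have "\<dots> \<le> (onorm (L i) * norm h) * norm (e i)"
        using onorm[OF L(1)[OF i]] by (intro mult_right_mono) auto
      finally show "L i h \<bullet> e i \<le> norm h * (\<bar>onorm (L i)\<bar> * \<bar>norm (e i)\<bar>)"
        using onorm_pos_le[OF L(1)[OF i]] by (simp add: algebra_simps)
    qed
    also have "\<dots> = norm h * (\<Sum>i=1..m. \<bar>onorm (L i)\<bar> * \<bar>norm (e i)\<bar>)" by (simp add: sum_distrib_left)
    also have "\<dots> \<le> norm h * (l * norm (snd (p - p')))"
      unfolding ne using L2_set_mult_ineq[of "\<lambda>i. onorm (L i)" "\<lambda>i. norm (e i)" "{1..m}"]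
      by (intro mult_left_mono) (auto simp: l_def L2_set_def)
    finally show ?thesis using False by simp
  qed (use l0 in simp)
  have nS2: "norm (snd S) \<le> l * norm d"
  proof -
    have "norm (snd S) = L2_set (\<lambda>i. norm (coord (snd S) i)) {1..m}"
      by (rule norm_eq_L2_set) (auto simp: S_def coord_family)
    also have "\<dots> \<le> L2_set (\<lambda>i. onorm (L i) * norm d) {1..m}"
      using onorm[OF L(1)] by (intro L2_set_mono) (auto simp: S_def coord_family)
    also have "\<dots> = l * norm d" by (simp add: L2_set_left_distrib[symmetric] l_def L2_set_def power_mult_distrib real_sqrt_mult flip: sum_distrib_right)
    finally show ?thesis .
  qed
  have nS: "norm S \<le> l * norm (p - p')"
  proof -
    have "sqrt ((norm (fst S))\<^sup>2 + (norm (snd S))\<^sup>2) \<le> sqrt ((l * norm (snd (p - p')))\<^sup>2 + (l * norm d)\<^sup>2)"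
      using nh nS2 by (intro real_sqrt_le_mono add_mono power_mono) (auto simp: S_def)
    also have "\<dots> = l * norm (p - p')"
      using l0 by (simp add: norm_prod_def d_def power_mult_distrib real_sqrt_mult add.commute flip: distrib_left)
    finally show ?thesis by (simp add: norm_prod_def)
  qed
  have "norm (Q p - Q p') \<le> norm U + norm S" unfolding split by (rule norm_triangle_ineq)
  then show "dist (Q p) (Q p') \<le> (\<kappa> + sqrt (\<Sum>i=1..m. (onorm (L i))\<^sup>2)) * dist p p'"
    using nU nS unfolding l_def[symmetric] dist_norm distrib_right by linarith
qed

text \<open>
  The optimality system that couples a primal and a dual solution.
\<close>

definition kkt :: "'h \<Rightarrow> (nat \<Rightarrow> 'g) \<Rightarrow> bool" where
  "kkt x v \<longleftrightarrow> z - (\<Sum>j=1..m. adjoint (L j) (v j)) \<in> A x + {C x} \<and>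
     (\<forall>i\<in>{1..m}. L i x - r i \<in> op_inverse (B i) (v i) + op_inverse (D i) (v i))"

lemma in_direct_sum_if_kkt:
  assumes "kkt x v" "i \<in> {1..m}" shows "v i \<in> G i"
proof -
  have "L i x - r i \<in> op_inverse (B i) (v i) + op_inverse (D i) (v i)"
    using assms by (simp add: kkt_def)
  then obtain s where "s \<in> op_inverse (B i) (v i)" by (rule set_plus_elim)
  from operator_onD[OF Binv_on[OF assms(2)] this] show ?thesis by simp
qed

lemma kkt_iff_zero:
  assumes V: "V \<in> direct_sum m G"
  shows "kkt x (coord V) \<longleftrightarrow> - Q (x, V) \<in> M (x, V)"
proof -
  have VG: "coord V i \<in> G i" if "i \<in> {1..m}" for i using V that by (simp add: direct_sum_def)
  have Kx: "- Q (x, V) \<in> K"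
    using Q_in_K[of "(x, V)"] V subspace_K by (simp add: K_def subspace_neg)
  have primal: "z - s \<in> A x + {C x} \<longleftrightarrow> z - (C x + s) \<in> A x" for s
  proof
    assume "z - s \<in> A x + {C x}"
    then obtain a where "a \<in> A x" "z - s = a + C x" by (auto simp: set_plus_def)
    moreover from this(2) have "z - (C x + s) = a" by (simp add: algebra_simps)
    ultimately show "z - (C x + s) \<in> A x" by simp
  next
    assume "z - (C x + s) \<in> A x"
    then have "z - (C x + s) + C x \<in> A x + {C x}" by (intro set_plus_intro) auto
    then show "z - s \<in> A x + {C x}" by simp
  qed
  have dual: "L i x - r i \<in> op_inverse (B i) (coord V i) + op_inverse (D i) (coord V i) \<longleftrightarrow>
      - (Dinv i (coord V i) - L i x) - r i \<in> op_inverse (B i) (coord V i)" if i: "i \<in> {1..m}" for i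
  proof -
    have "L i x - r i \<in> op_inverse (B i) (coord V i) + {Dinv i (coord V i)} \<longleftrightarrow>
      (L i x - r i) - Dinv i (coord V i) \<in> op_inverse (B i) (coord V i)"
      by (auto simp: set_plus_def) (metis diff_add_cancel)
    then show ?thesis using op_inverse_D[OF i VG[OF i]] by (simp add: algebra_simps)
  qed
  have cQ: "coord (- snd (Q (x, V))) i = - (Dinv i (coord V i) - L i x)" if "i \<in> {1..m}" for i
    using that by (simp add: Q_def uminus_ell2.rep_eq coord_family)
  have "- snd (Q (x, V)) \<in> direct_sum m G" using Kx by (simp add: K_def mem_Times_iff)
  then have "- Q (x, V) \<in> M (x, V) \<longleftrightarrow>
      z - (C x + (\<Sum>j=1..m. adjoint (L j) (coord V j))) \<in> A x \<and>
      (\<forall>i\<in>{1..m}. - (Dinv i (coord V i) - L i x) - r i \<in> op_inverse (B i) (coord V i))"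
    using V cQ by (simp add: M_def) (simp add: Q_def)
  then show ?thesis unfolding kkt_def primal using dual by simp
qed

text \<open>
  Unfold the Minkowski sums and choose the dual vectors that witness the membership.
\<close>

lemma kkt_if_primal_solution:
  assumes "z \<in> primal_op m A B D L r C x"
  obtains v where "kkt x v"
proof -
  let ?S = "\<lambda>i. adjoint (L i) ` parallel_sum (B i) (D i) (L i x - r i)"
  obtain a s where a: "a \<in> A x" and s: "s \<in> (\<Sum>i=1..m. ?S i)" and z: "z = a + s + C x"
    using assms by (auto simp: primal_op_def elim!: set_plus_elim)
  from s obtain t where t: "s = sum t {1..m}" "\<And>i. i \<in> {1..m} \<Longrightarrow> t i \<in> ?S i"
    by (auto simp: set_sum_alt)
  then have "\<forall>i\<in>{1..m}. \<exists>v. t i = adjoint (L i) v \<and> v \<in> parallel_sum (B i) (D i) (L i x - r i)" by blast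
  then obtain v where v: "\<And>i. i \<in> {1..m} \<Longrightarrow> t i = adjoint (L i) (v i)"
    "\<And>i. i \<in> {1..m} \<Longrightarrow> v i \<in> parallel_sum (B i) (D i) (L i x - r i)" by metis
  have "z - (\<Sum>j=1..m. adjoint (L j) (v j)) = a + C x" using z t v(1) by simp
  with a have "z - (\<Sum>j=1..m. adjoint (L j) (v j)) \<in> A x + {C x}" by (simp add: set_plus_intro)
  moreover have "\<forall>i\<in>{1..m}. L i x - r i \<in> op_inverse (B i) (v i) + op_inverse (D i) (v i)"
    using v(2) by (simp add: parallel_sum_def op_inverse_def[of "\<lambda>u. _ u + _ u"])
  ultimately have "kkt x v" by (simp add: kkt_def)
  then show thesis by (rule that)
qed

lemma solutions_if_kkt:
  assumes kkt: "kkt x v"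
  shows "primal_solution m z A B D L r C x"
    and "dual_solution m G z A B D L r C v"
    and "i \<in> {1..m} \<Longrightarrow> - r i \<in> (\<lambda>w. - L i w) `
           parallel_sum (op_inverse A) (op_inverse (single_valued_op C)) (z - (\<Sum>j=1..m. adjoint (L j) (v j)))
         + op_inverse (B i) (v i) + op_inverse (D i) (v i)"
proof -
  have 1: "z - (\<Sum>j=1..m. adjoint (L j) (v j)) \<in> A x + {C x}"
    and 2: "\<And>i. i \<in> {1..m} \<Longrightarrow> L i x - r i \<in> op_inverse (B i) (v i) + op_inverse (D i) (v i)"
    using kkt by (auto simp: kkt_def)
  have 3: "v i \<in> parallel_sum (B i) (D i) (L i x - r i)" if "i \<in> {1..m}" for i
    using 2[OF that] by (simp add: parallel_sum_def op_inverse_def[of "\<lambda>u. _ u + _ u"])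
  show "dual_solution m G z A B D L r C v"
    unfolding dual_solution_def using in_direct_sum_if_kkt[OF kkt] 1 3 by blast
  obtain a where a: "a \<in> A x" "z - (\<Sum>j=1..m. adjoint (L j) (v j)) = a + C x"
    using 1 by (auto simp: set_plus_def)
  have "(\<Sum>i=1..m. adjoint (L i) (v i)) \<in> (\<Sum>i=1..m. adjoint (L i) ` parallel_sum (B i) (D i) (L i x - r i))"
    unfolding set_sum_alt[OF finite_atLeastAtMost] using 3 by auto
  then have "a + (\<Sum>i=1..m. adjoint (L i) (v i)) + C x \<in> primal_op m A B D L r C x"
    unfolding primal_op_def using a(1) by (intro set_plus_intro) auto
  moreover have "a + (\<Sum>i=1..m. adjoint (L i) (v i)) + C x = z" using a(2) by (simp add: algebra_simps)
  ultimately show "primal_solution m z A B D L r C x" by (simp add: primal_solution_def)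
  assume i: "i \<in> {1..m}"
  have x: "x \<in> parallel_sum (op_inverse A) (op_inverse (single_valued_op C)) (z - (\<Sum>j=1..m. adjoint (L j) (v j)))"
    using 1 by (simp add: parallel_sum_def op_inverse_def single_valued_op_def)
  obtain s d where sd: "s \<in> op_inverse (B i) (v i)" "d \<in> op_inverse (D i) (v i)" "L i x - r i = s + d"
    using 2[OF i] by (auto simp: set_plus_def)
  have "- r i = - L i x + s + d" using sd(3) by (simp add: algebra_simps)
  also have "\<dots> \<in> (\<lambda>w. - L i w) `
           parallel_sum (op_inverse A) (op_inverse (single_valued_op C)) (z - (\<Sum>j=1..m. adjoint (L j) (v j)))
         + op_inverse (B i) (v i) + op_inverse (D i) (v i)"
    using x sd by (intro set_plus_intro imageI)
  finally show "- r i \<in> \<dots>" .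
qed

text \<open>
  The inner product in \<open>lim\<close> is the sum of the nonnegative sequences \<open>a\<close>, \<open>b i\<close>, \<open>c\<close>, \<open>d i\<close> below, which
  measure the monotonicity of \<open>A\<close>, of the inverse of \<open>B i\<close>, of \<open>C\<close>, and of the inverse of \<open>D i\<close>
  along the sequence; each of them is therefore null.
\<close>

lemma strong_convergence:
  assumes zero: "- Q zb \<in> M zb" and p: "\<And>n. w n \<in> M (p n)"
    and lim: "(\<lambda>n. (p n - zb) \<bullet> (w n + Q (p n))) \<longlonglongrightarrow> 0"
  shows "uniformly_monotone_at A (fst zb) \<or> uniformly_monotone_at (single_valued_op C) (fst zb) \<Longrightarrow>
      (\<lambda>n. fst (p n)) \<longlonglongrightarrow> fst zb"
    and "i \<in> {1..m} \<Longrightarrow> uniformly_monotone_at (op_inverse (B i)) (coord (snd zb) i) \<or>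
      uniformly_monotone_at (op_inverse (D i)) (coord (snd zb) i) \<Longrightarrow>
      (\<lambda>n. coord (snd (p n)) i) \<longlonglongrightarrow> coord (snd zb) i"
proof -
  define a where "a = (\<lambda>n. (fst (p n) - fst zb) \<bullet> ((fst (w n) + z) - (fst (- Q zb) + z)))"
  define b where "b = (\<lambda>i n. (coord (snd (p n)) i - coord (snd zb) i) \<bullet>
    ((coord (snd (w n)) i - r i) - (coord (snd (- Q zb)) i - r i)))"
  define c where "c = (\<lambda>n. (fst (p n) - fst zb) \<bullet> (C (fst (p n)) - C (fst zb)))"
  define d where "d = (\<lambda>i n. (coord (snd (p n)) i - coord (snd zb) i) \<bullet>
    (Dinv i (coord (snd (p n)) i) - Dinv i (coord (snd zb) i)))"
  have pK: "p n \<in> K" and zK: "zb \<in> K" for n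
    using operator_onD[OF operator_on_M] p zero by blast+
  have nonneg: "0 \<le> a n" "0 \<le> c n" "i \<in> {1..m} \<Longrightarrow> 0 \<le> b i n" "i \<in> {1..m} \<Longrightarrow> 0 \<le> d i n" for i n
    unfolding a_def b_def c_def d_def
    by (rule monotone_M_parts[OF p zero] monotone_Q_parts[OF pK zK]; assumption)+
  define T where "T = (\<lambda>n. (p n - zb) \<bullet> (w n + Q (p n)))"
  have T: "T n = (a n + (\<Sum>i=1..m. b i n)) + (c n + (\<Sum>i=1..m. d i n))" for n
  proof -
    have "T n = (p n - zb) \<bullet> (w n - (- Q zb)) + (p n - zb) \<bullet> (Q (p n) - Q zb)"
      unfolding T_def inner_add_right[symmetric] by simp
    then show ?thesis unfolding inner_M[OF p zero] inner_Q[OF pK zK] a_def b_def c_def d_def .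
  qed
  have sums: "0 \<le> (\<Sum>i=1..m. b i n)" "0 \<le> (\<Sum>i=1..m. d i n)" for n
    using nonneg by (auto intro!: sum_nonneg)
  have null: "f \<longlonglongrightarrow> 0" if "\<And>n. 0 \<le> f n" "\<And>n. f n \<le> T n" for f
    using lim that unfolding T_def[symmetric] by (intro tendsto_sandwich[of "\<lambda>_. 0" f _ T]) auto
  have a0: "a \<longlonglongrightarrow> 0" and c0: "c \<longlonglongrightarrow> 0"
    using nonneg sums by (auto intro!: null simp: T add_nonneg_nonneg add_increasing add_increasing2)
  have b0: "b i \<longlonglongrightarrow> 0" and d0: "d i \<longlonglongrightarrow> 0" if i: "i \<in> {1..m}" for i
  proof -
    have le: "b i n \<le> (\<Sum>i=1..m. b i n)" "d i n \<le> (\<Sum>i=1..m. d i n)" for n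
      using nonneg i by (auto intro!: member_le_sum)
    then have "b i n \<le> T n" "d i n \<le> T n" for n
      unfolding T using nonneg(1,2)[of n] sums[of n] le[of n] by linarith+
    then show "b i \<longlonglongrightarrow> 0" "d i \<longlonglongrightarrow> 0" using nonneg i by (auto intro!: null)
  qed
  show "(\<lambda>n. fst (p n)) \<longlonglongrightarrow> fst zb"
    if "uniformly_monotone_at A (fst zb) \<or> uniformly_monotone_at (single_valued_op C) (fst zb)"
    using that
  proof
    assume "uniformly_monotone_at A (fst zb)"
    then show ?thesis
    proof (rule uniformly_monotone_at_tendsto)
      show "fst (- Q zb) + z \<in> A (fst zb)" "fst (w n) + z \<in> A (fst (p n))" for n
        using p[of n] zero by (auto simp: M_def)
    qed (use a0 in \<open>simp add: a_def\<close>)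
  next
    assume "uniformly_monotone_at (single_valued_op C) (fst zb)"
    then show ?thesis
    proof (rule uniformly_monotone_at_tendsto)
      show "C (fst zb) \<in> single_valued_op C (fst zb)"
        "C (fst (p n)) \<in> single_valued_op C (fst (p n))" for n by (auto simp: single_valued_op_def)
    qed (use c0 in \<open>simp add: c_def\<close>)
  qed
  show "(\<lambda>n. coord (snd (p n)) i) \<longlonglongrightarrow> coord (snd zb) i"
    if i: "i \<in> {1..m}" and um: "uniformly_monotone_at (op_inverse (B i)) (coord (snd zb) i) \<or>
      uniformly_monotone_at (op_inverse (D i)) (coord (snd zb) i)"
    using um
  proof
    assume "uniformly_monotone_at (op_inverse (B i)) (coord (snd zb) i)"
    then show ?thesis
    proof (rule uniformly_monotone_at_tendsto)
      show "coord (snd (- Q zb)) i - r i \<in> op_inverse (B i) (coord (snd zb) i)"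
        "coord (snd (w n)) i - r i \<in> op_inverse (B i) (coord (snd (p n)) i)" for n
        using p[of n] zero i by (auto simp: M_def)
    qed (use b0[OF i] in \<open>simp add: b_def\<close>)
  next
    have G: "coord (snd zb) i \<in> G i" "coord (snd (p n)) i \<in> G i" for n
      using pK[of n] zK i by (simp_all add: K_def direct_sum_def mem_Times_iff)
    assume "uniformly_monotone_at (op_inverse (D i)) (coord (snd zb) i)"
    then show ?thesis
    proof (rule uniformly_monotone_at_tendsto)
      show "Dinv i (coord (snd zb) i) \<in> op_inverse (D i) (coord (snd zb) i)"
        "Dinv i (coord (snd (p n)) i) \<in> op_inverse (D i) (coord (snd (p n)) i)" for n
        using op_inverse_D[OF i] G by auto
    qed (use d0[OF i] in \<open>simp add: d_def\<close>)
  qed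
qed

end

section \<open>Convergence of the primal-dual algorithm\<close>

theorem theorem3p1:
  fixes z :: "'h::{real_inner, complete_space}"
    and m :: nat
    and A :: "'h \<Rightarrow> 'h set"
    and C :: "'h \<Rightarrow> 'h"
    and \<mu> :: real
    and G :: "nat \<Rightarrow> 'g::{real_inner, complete_space} set"
    and r :: "nat \<Rightarrow> 'g"
    and B D :: "nat \<Rightarrow> 'g \<Rightarrow> 'g set"
    and \<nu> :: "nat \<Rightarrow> real"
    and L :: "nat \<Rightarrow> 'h \<Rightarrow> 'g"
    and a1 b1 c1 :: "nat \<Rightarrow> 'h"
    and a2 b2 c2 :: "nat \<Rightarrow> nat \<Rightarrow> 'g"
    and \<beta> \<epsilon> :: real
    and \<gamma> :: "nat \<Rightarrow> real"
    and x y1 p1 q1 :: "nat \<Rightarrow> 'h"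
    and v y2 p2 q2 :: "nat \<Rightarrow> nat \<Rightarrow> 'g"
  assumes m: "m \<ge> 1"
    and A: "maximally_monotone_on UNIV A"
    and C_mono: "monotone_op (single_valued_op C)"
    and \<mu>: "\<mu> > 0"
    and C_lipschitz: "\<mu>-lipschitz_on UNIV C"
    and G: "\<And>i. i \<in> {1..m} \<Longrightarrow> subspace (G i) \<and> closed (G i)"
    and r: "\<And>i. i \<in> {1..m} \<Longrightarrow> r i \<in> G i"
    and B: "\<And>i. i \<in> {1..m} \<Longrightarrow> maximally_monotone_on (G i) (B i)"
    and D: "\<And>i. i \<in> {1..m} \<Longrightarrow> operator_on (G i) (D i) \<and> monotone_op (D i)"
    and \<nu>: "\<And>i. i \<in> {1..m} \<Longrightarrow> \<nu> i > 0"
    and D_inv_lipschitz: "\<And>i. i \<in> {1..m} \<Longrightarrow> lipschitzian_op_on (\<nu> i) (G i) (op_inverse (D i))"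
    and L: "\<And>i. i \<in> {1..m} \<Longrightarrow> bounded_linear (L i) \<and> range (L i) \<subseteq> G i \<and> L i \<noteq> (\<lambda>_. 0)"
    and z_ran: "z \<in> op_ran (primal_op m A B D L r C)"
    and err1: "summable (\<lambda>n. norm (a1 n))" "summable (\<lambda>n. norm (b1 n))"
              "summable (\<lambda>n. norm (c1 n))"
    and err2_in: "\<And>i n. i \<in> {1..m} \<Longrightarrow> a2 i n \<in> G i \<and> b2 i n \<in> G i \<and> c2 i n \<in> G i"
    and err2: "\<And>i. i \<in> {1..m} \<Longrightarrow> summable (\<lambda>n. norm (a2 i n))"
              "\<And>i. i \<in> {1..m} \<Longrightarrow> summable (\<lambda>n. norm (b2 i n))"
              "\<And>i. i \<in> {1..m} \<Longrightarrow> summable (\<lambda>n. norm (c2 i n))"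
    and \<beta>: "\<beta> = Max (insert \<mu> (\<nu> ` {1..m})) + sqrt (\<Sum>i=1..m. (onorm (L i))\<^sup>2)"
    and v0: "\<And>i. i \<in> {1..m} \<Longrightarrow> v i 0 \<in> G i"
    and \<epsilon>: "\<epsilon> \<in> {0<..<1 / (\<beta> + 1)}"
    and \<gamma>: "\<And>n. \<gamma> n \<in> {\<epsilon>..(1 - \<epsilon>) / \<beta>}"
    and y1: "\<And>n. y1 n = x n - \<gamma> n *\<^sub>R (C (x n) + (\<Sum>i=1..m. adjoint (L i) (v i n)) + a1 n)"
    and p1: "\<And>n. p1 n = the_elem (resolvent (scale_op (\<gamma> n) A) (y1 n + \<gamma> n *\<^sub>R z)) + b1 n"
    and y2: "\<And>i n. i \<in> {1..m} \<Longrightarrow>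
               y2 i n = v i n + \<gamma> n *\<^sub>R (L i (x n) - the_elem (op_inverse (D i) (v i n)) + a2 i n)"
    and p2: "\<And>i n. i \<in> {1..m} \<Longrightarrow>
               p2 i n = the_elem (resolvent (scale_op (\<gamma> n) (op_inverse (B i)))
                                    (y2 i n - \<gamma> n *\<^sub>R r i)) + b2 i n"
    and q2: "\<And>i n. i \<in> {1..m} \<Longrightarrow>
               q2 i n = p2 i n
                 + \<gamma> n *\<^sub>R (L i (p1 n) - the_elem (op_inverse (D i) (p2 i n)) + c2 i n)"
    and v_Suc: "\<And>i n. i \<in> {1..m} \<Longrightarrow> v i (Suc n) = v i n - y2 i n + q2 i n"
    and q1: "\<And>n. q1 n = p1 n - \<gamma> n *\<^sub>R (C (p1 n) + (\<Sum>i=1..m. adjoint (L i) (p2 i n)) + c1 n)"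
    and x_Suc: "\<And>n. x (Suc n) = x n - y1 n + q1 n"
  shows
    "(summable (\<lambda>n. (norm (x n - p1 n))\<^sup>2) \<and>
      (\<forall>i\<in>{1..m}. summable (\<lambda>n. (norm (v i n - p2 i n))\<^sup>2)))
     \<and>
     (\<exists>xb vb.
        primal_solution m z A B D L r C xb \<and>
        dual_solution m G z A B D L r C vb \<and>
        (z - (\<Sum>j=1..m. adjoint (L j) (vb j)) \<in> A xb + {C xb} \<and>
         (\<forall>i\<in>{1..m}. L i xb - r i \<in> op_inverse (B i) (vb i) + op_inverse (D i) (vb i))) \<and>
        (\<forall>i\<in>{1..m}.
           - r i \<in> (\<lambda>w. - L i w) `
                     parallel_sum (op_inverse A) (op_inverse (single_valued_op C))
                       (z - (\<Sum>j=1..m. adjoint (L j) (vb j)))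
                   + op_inverse (B i) (vb i) + op_inverse (D i) (vb i)) \<and>
        (weakly_converges_on UNIV x xb \<and> weakly_converges_on UNIV p1 xb) \<and>
        (\<forall>i\<in>{1..m}. weakly_converges_on (G i) (v i) (vb i) \<and>
                     weakly_converges_on (G i) (p2 i) (vb i)) \<and>
        (uniformly_monotone_at A xb \<or> uniformly_monotone_at (single_valued_op C) xb \<longrightarrow>
           x \<longlonglongrightarrow> xb \<and> p1 \<longlonglongrightarrow> xb) \<and>
        (\<forall>i\<in>{1..m}.
           uniformly_monotone_at (op_inverse (B i)) (vb i) \<or>
           uniformly_monotone_at (op_inverse (D i)) (vb i) \<longrightarrow>
             v i \<longlonglongrightarrow> vb i \<and> p2 i \<longlonglongrightarrow> vb i))"
proof -
  interpret primal_dual z m A C \<mu> G r B D \<nu> L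
    by (rule primal_dual.intro; use A C_mono C_lipschitz G r B D D_inv_lipschitz L in blast)
  define \<kappa> where "\<kappa> = Max (insert \<mu> (\<nu> ` {1..m}))"
  have \<kappa>: "\<mu> \<le> \<kappa>" "\<And>i. i \<in> {1..m} \<Longrightarrow> \<nu> i \<le> \<kappa>"
    unfolding \<kappa>_def by (intro Max_ge; simp)+
  have lip: "\<beta>-lipschitz_on K Q" unfolding \<beta> \<kappa>_def[symmetric] by (rule lipschitz_Q[OF \<kappa>])
  have \<beta>0: "\<beta> > 0"
    unfolding \<beta> \<kappa>_def[symmetric] using \<mu> \<kappa>(1) by (intro add_pos_nonneg) (auto intro!: sum_nonneg)
  have \<epsilon>': "0 < \<epsilon>" "\<epsilon> < 1"
  proof -
    have "1 / (\<beta> + 1) < 1" using \<beta>0 by simp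
    then show "0 < \<epsilon>" "\<epsilon> < 1" using \<epsilon> by (auto intro: less_trans)
  qed
  have \<gamma>': "\<epsilon> \<le> \<gamma> n" "\<gamma> n * \<beta> \<le> 1 - \<epsilon>" for n using \<gamma>[of n] \<beta>0 by (auto simp: field_simps)
  have \<gamma>0: "\<gamma> n > 0" for n using \<gamma>'(1)[of n] \<epsilon>'(1) by linarith
  have zero: "\<exists>p. - Q p \<in> M p"
  proof -
    obtain x' where "z \<in> primal_op m A B D L r C x'" using z_ran by (auto simp: op_ran_def)
    then obtain v' where kkt: "kkt x' v'" by (rule kkt_if_primal_solution)
    define V where "V = family m v'"
    have V: "V \<in> direct_sum m G"
      unfolding V_def by (intro family_in_direct_sum in_direct_sum_if_kkt[OF kkt])
    have "kkt x' (coord V)" using kkt by (simp add: kkt_def V_def coord_family)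
    then show ?thesis using kkt_iff_zero[OF V] by blast
  qed
  define X where "X = (\<lambda>n. (x n, family m (\<lambda>i. v i n)))"
  define P where "P = (\<lambda>n. (p1 n, family m (\<lambda>i. p2 i n)))"
  \<comment> \<open>The dual errors \<open>a2\<close>, \<open>c2\<close> change sign, because the algorithm adds them to \<open>L i x - D\<^sub>i\<^sup>-\<^sup>1 v\<close>, the
    negative of a component of \<open>Q\<close>.\<close>
  define a where "a = (\<lambda>n. (a1 n, family m (\<lambda>i. - a2 i n)))"
  define b where "b = (\<lambda>n. (b1 n, family m (\<lambda>i. b2 i n)))"
  define c where "c = (\<lambda>n. (c1 n, family m (\<lambda>i. - c2 i n)))"
  define pt where "pt = (\<lambda>n. (p1 n - b1 n, family m (\<lambda>i. p2 i n - b2 i n)))"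
  \<comment> \<open>The elements that certify the resolvents: \<open>pt n + \<gamma> n *\<^sub>R w n\<close> has the components \<open>y1 n\<close>, \<open>y2 i n\<close>.\<close>
  define w where "w = (\<lambda>n. ((1 / \<gamma> n) *\<^sub>R (y1 n - fst (pt n)),
    family m (\<lambda>i. (1 / \<gamma> n) *\<^sub>R (y2 i n - (p2 i n - b2 i n)))))"
  note coords = coord_family plus_ell2.rep_eq minus_ell2.rep_eq scaleR_ell2.rep_eq
  have errK: "a n \<in> K" "b n \<in> K" "c n \<in> K" for n
    unfolding a_def b_def c_def K_def using err2_in G
    by (auto intro!: family_in_direct_sum subspace_neg)
  have sums: "summable (\<lambda>n. norm (a n))" "summable (\<lambda>n. norm (b n))" "summable (\<lambda>n. norm (c n))"
  proof -
    have *: "summable (\<lambda>n. norm (f n, family m (\<lambda>i. g i n)))"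
      if "summable (\<lambda>n. norm (f n))" "\<And>i. i \<in> {1..m} \<Longrightarrow> summable (\<lambda>n. norm (g i n))"
      for f :: "nat \<Rightarrow> 'h" and g :: "nat \<Rightarrow> nat \<Rightarrow> 'g"
    proof (rule summable_comparison_test')
      show "summable (\<lambda>n. norm (f n) + (\<Sum>i=1..m. norm (g i n)))"
        by (intro summable_add summable_sum that)
      show "norm (norm (f n, family m (\<lambda>i. g i n))) \<le> norm (f n) + (\<Sum>i=1..m. norm (g i n))" for n
        using norm_Pair_le[of "f n" "family m (\<lambda>i. g i n)"] norm_family_le[of m "\<lambda>i. g i n"] by simp
    qed
    show "summable (\<lambda>n. norm (a n))" "summable (\<lambda>n. norm (b n))" "summable (\<lambda>n. norm (c n))"
      unfolding a_def b_def c_def by (intro *; simp add: err1 err2)+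
  qed
  have XK: "X n \<in> K \<longleftrightarrow> (\<forall>i\<in>{1..m}. v i n \<in> G i)" for n
    by (auto simp: X_def K_def direct_sum_def coord_family)
  have backward: "w n \<in> M (pt n) \<and> pt n + \<gamma> n *\<^sub>R w n = X n - \<gamma> n *\<^sub>R (Q (X n) + a n) \<and> P n = pt n + b n"
    if "X n \<in> K" for n
  proof (intro conjI)
    have vG: "v i n \<in> G i" if "i \<in> {1..m}" for i using \<open>X n \<in> K\<close> XK that by blast
    have y2G: "y2 i n \<in> G i" if i: "i \<in> {1..m}" for i
      unfolding y2[OF i] using vG[OF i] Dinv_in[OF i vG[OF i]] L err2_in[OF i] G i
      by (auto simp: Dinv_def intro!: subspace_add subspace_diff subspace_scale)
    have J1: "the_elem (resolvent (scale_op (\<gamma> n) A) (y1 n + \<gamma> n *\<^sub>R z)) = p1 n - b1 n"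
      by (simp add: p1)
    obtain u where u: "u \<in> A (p1 n - b1 n)" "(p1 n - b1 n) + \<gamma> n *\<^sub>R u = y1 n + \<gamma> n *\<^sub>R z"
      by (rule the_elem_resolvent[OF subspace_UNIV closed_UNIV A \<gamma>0 UNIV_I,
            of n "y1 n + \<gamma> n *\<^sub>R z", unfolded J1])
    have "fst (w n) + z = u"
    proof -
      have "y1 n - (p1 n - b1 n) = \<gamma> n *\<^sub>R (u - z)" using u(2) by (simp add: algebra_simps)
      then show ?thesis using \<gamma>0[of n] by (simp add: w_def pt_def)
    qed
    moreover have dual: "coord (snd (w n)) i - r i \<in> op_inverse (B i) (p2 i n - b2 i n)" if i: "i \<in> {1..m}" for i
    proof -
      have y: "y2 i n - \<gamma> n *\<^sub>R r i \<in> G i"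
        using y2G[OF i] r[OF i] G[OF i] by (auto intro!: subspace_diff subspace_scale)
      have J2: "the_elem (resolvent (scale_op (\<gamma> n) (op_inverse (B i))) (y2 i n - \<gamma> n *\<^sub>R r i)) = p2 i n - b2 i n"
        by (simp add: p2[OF i])
      obtain u where u: "u \<in> op_inverse (B i) (p2 i n - b2 i n)"
        "(p2 i n - b2 i n) + \<gamma> n *\<^sub>R u = y2 i n - \<gamma> n *\<^sub>R r i"
        by (rule the_elem_resolvent[OF G(1)[OF i] G(2)[OF i] Binv[OF i] \<gamma>0 y, of n, unfolded J2])
      have "y2 i n - (p2 i n - b2 i n) = \<gamma> n *\<^sub>R (u + r i)" using u(2) by (simp add: algebra_simps)
      then have "coord (snd (w n)) i = u + r i" using \<gamma>0[of n] i by (simp add: w_def coord_family)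
      with u(1) show ?thesis by simp
    qed
    moreover have ptG: "p2 i n - b2 i n \<in> G i" if i: "i \<in> {1..m}" for i
      using operator_onD[OF Binv_on[OF i] dual[OF i]] by simp
    moreover have "snd (w n) \<in> direct_sum m G"
      unfolding w_def snd_conv
      by (intro family_in_direct_sum subspace_scale subspace_diff[OF _ y2G ptG] G)
    ultimately show "w n \<in> M (pt n)"
      using u(1) by (auto simp: M_def pt_def coord_family intro!: family_in_direct_sum)
    show "P n = pt n + b n"
      by (auto simp: P_def pt_def b_def coords intro!: ell2_eqI)
    have "y1 n = fst (X n - \<gamma> n *\<^sub>R (Q (X n) + a n))"
      by (simp add: y1 X_def Q_def a_def coord_family)
    moreover have "coord (snd (X n - \<gamma> n *\<^sub>R (Q (X n) + a n))) i = (if i \<in> {1..m} then y2 i n else 0)" for i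
      using y2[of i n] by (auto simp: X_def Q_def a_def coords Dinv_def algebra_simps)
    ultimately show "pt n + \<gamma> n *\<^sub>R w n = X n - \<gamma> n *\<^sub>R (Q (X n) + a n)"
      using \<gamma>0[of n]
      by (intro prod_eqI ell2_eqI) (auto simp: pt_def w_def coords)
  qed
  have X_Suc: "X (Suc n) = P n + \<gamma> n *\<^sub>R (Q (X n) + a n) - \<gamma> n *\<^sub>R (Q (P n) + c n)" for n
  proof (rule prod_eqI)
    show "fst (X (Suc n)) = fst (P n + \<gamma> n *\<^sub>R (Q (X n) + a n) - \<gamma> n *\<^sub>R (Q (P n) + c n))"
      by (simp add: X_def P_def Q_def a_def c_def x_Suc y1 q1 coord_family)
    show "snd (X (Suc n)) = snd (P n + \<gamma> n *\<^sub>R (Q (X n) + a n) - \<gamma> n *\<^sub>R (Q (P n) + c n))"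
    proof (rule ell2_eqI)
      fix i
      show "coord (snd (X (Suc n))) i = coord (snd (P n + \<gamma> n *\<^sub>R (Q (X n) + a n) - \<gamma> n *\<^sub>R (Q (P n) + c n))) i"
        using v_Suc[of i n] y2[of i n] q2[of i n]
        by (auto simp: X_def P_def Q_def a_def c_def coords Dinv_def algebra_simps)
    qed
  qed
  have X0: "X 0 \<in> K" using v0 by (simp add: XK)
  obtain zb where zb: "- Q zb \<in> M zb" and sumXP: "summable (\<lambda>n. (norm (X n - P n))\<^sup>2)"
    and weakX: "weakly_converges_on UNIV X zb" and weakP: "weakly_converges_on UNIV P zb"
    and "\<forall>n. w n \<in> M (pt n)"
    and Xpt: "(\<lambda>n. X n - pt n) \<longlonglongrightarrow> 0" and Ppt: "(\<lambda>n. P n - pt n) \<longlonglongrightarrow> 0"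
    and inner: "(\<lambda>n. (pt n - zb) \<bullet> (w n + Q (pt n))) \<longlonglongrightarrow> 0"
    by (rule forward_backward_forward_converges[OF subspace_K closed_K operator_on_M monotone_M
      surjective_M Q_in_K monotone_Q lip \<beta>0 zero \<epsilon>' \<gamma>' X0 errK sums backward X_Suc])
  then have wM: "w n \<in> M (pt n)" for n by blast
  obtain xb V where zbeq: "zb = (xb, V)" by (cases zb)
  have V: "V \<in> direct_sum m G" using zb by (simp add: M_def zbeq)
  have kkt: "kkt xb (coord V)" using kkt_iff_zero[OF V] zb zbeq by simp
  have "norm (x n - p1 n) \<le> norm (X n - P n)" for n
    using norm_fst_le[of "fst (X n - P n)" "snd (X n - P n)"] by (simp add: X_def P_def)
  then have sum1: "summable (\<lambda>n. (norm (x n - p1 n))\<^sup>2)"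
    by (intro summable_comparison_test'[OF sumXP]) (simp add: power_mono)
  have "norm (v i n - p2 i n) \<le> norm (X n - P n)" if "i \<in> {1..m}" for i n
    using norm_coord_le[of "snd (X n - P n)" i] norm_snd_le[of "snd (X n - P n)" "fst (X n - P n)"] that
    by (simp add: X_def P_def coords)
  then have sum2: "summable (\<lambda>n. (norm (v i n - p2 i n))\<^sup>2)" if "i \<in> {1..m}" for i
    using that by (intro summable_comparison_test'[OF sumXP]) (simp add: power_mono)
  have weak1: "weakly_converges_on UNIV x xb" "weakly_converges_on UNIV p1 xb"
  proof -
    have "(\<lambda>n. X n \<bullet> (u, 0)) \<longlonglongrightarrow> zb \<bullet> (u, 0)" "(\<lambda>n. P n \<bullet> (u, 0)) \<longlonglongrightarrow> zb \<bullet> (u, 0)" for u :: 'h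
      using weakX weakP by (auto simp: weakly_converges_on_def)
    then show "weakly_converges_on UNIV x xb" "weakly_converges_on UNIV p1 xb"
      by (simp_all add: weakly_converges_on_def X_def P_def zbeq)
  qed
  have weak2: "weakly_converges_on (G i) (v i) (coord V i)" "weakly_converges_on (G i) (p2 i) (coord V i)"
    if i: "i \<in> {1..m}" for i
  proof -
    \<comment> \<open>Testing against vectors with a single nonzero coordinate isolates the component \<open>i\<close>.\<close>
    define E where "E = (\<lambda>u :: 'g. family m (\<lambda>j. if j = i then u else 0))"
    have E: "F \<bullet> E u = coord F i \<bullet> u" for F u
    proof -
      have "F \<bullet> E u = (\<Sum>j=1..m. coord (E u) j \<bullet> coord F j)"
        unfolding inner_commute[of F] by (rule inner_eq_sum) (auto simp: E_def coord_family)
      also have "\<dots> = (\<Sum>j=1..m. if j = i then coord F i \<bullet> u else 0)"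
        by (intro sum.cong refl) (auto simp: E_def coord_family inner_commute)
      also have "\<dots> = coord F i \<bullet> u" using i by simp
      finally show ?thesis .
    qed
    have "(\<lambda>n. X n \<bullet> (0, E u)) \<longlonglongrightarrow> zb \<bullet> (0, E u)" "(\<lambda>n. P n \<bullet> (0, E u)) \<longlonglongrightarrow> zb \<bullet> (0, E u)" for u
      using weakX weakP by (auto simp: weakly_converges_on_def)
    then show "weakly_converges_on (G i) (v i) (coord V i)" "weakly_converges_on (G i) (p2 i) (coord V i)"
      using i by (simp_all add: weakly_converges_on_def X_def P_def zbeq E coord_family)
  qed
  have strong1: "x \<longlonglongrightarrow> xb \<and> p1 \<longlonglongrightarrow> xb"
    if "uniformly_monotone_at A xb \<or> uniformly_monotone_at (single_valued_op C) xb"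
  proof -
    have "(\<lambda>n. fst (pt n)) \<longlonglongrightarrow> xb"
      using strong_convergence(1)[OF zb wM inner] that by (simp add: zbeq)
    from tendsto_add[OF tendsto_fst[OF Xpt] this] tendsto_add[OF tendsto_fst[OF Ppt] this]
    show ?thesis by (simp add: X_def P_def)
  qed
  have strong2: "v i \<longlonglongrightarrow> coord V i \<and> p2 i \<longlonglongrightarrow> coord V i"
    if i: "i \<in> {1..m}" and um: "uniformly_monotone_at (op_inverse (B i)) (coord V i) \<or>
      uniformly_monotone_at (op_inverse (D i)) (coord V i)" for i
  proof -
    note tendsto_coord = bounded_linear.tendsto[OF bounded_linear_coord[of i] tendsto_snd]
    have "(\<lambda>n. coord (snd (pt n)) i) \<longlonglongrightarrow> coord V i"
      using strong_convergence(2)[OF zb wM inner i] um by (simp add: zbeq)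
    from tendsto_add[OF tendsto_coord[OF Xpt] this] tendsto_add[OF tendsto_coord[OF Ppt] this]
    show ?thesis using i by (simp add: X_def P_def coords zero_ell2.rep_eq)
  qed
  have primal_inclusion: "z - (\<Sum>j=1..m. adjoint (L j) (coord V j)) \<in> A xb + {C xb}"
    and dual_inclusion: "\<And>i. i \<in> {1..m} \<Longrightarrow>
      L i xb - r i \<in> op_inverse (B i) (coord V i) + op_inverse (D i) (coord V i)"
    using kkt by (auto simp only: kkt_def)
  show ?thesis
    by (intro conjI exI[of _ xb] exI[of _ "coord V"] ballI impI)
      (rule sum1 sum2 solutions_if_kkt[OF kkt] primal_inclusion dual_inclusion weak1 weak2
        strong1[THEN conjunct1] strong1[THEN conjunct2] strong2[THEN conjunct1]
        strong2[THEN conjunct2]; assumption)+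
qed

end
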